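(* Let $\pi:\mathbb R^3\to\mathbb R^2$ denote the orthogonal projection onto the first two coordinates. Consider sequences $x_1,\dots,x_N\in\mathbb R^3$ of points in general position such that $\pi(x_1),\dots,\pi(x_N)$ are the consecutive vertices of a convex polygon. For indices $i<i'<j<j'$, the projected segments $\pi(x_i)\pi(x_j)$ and $\pi(x_{i'})\pi(x_{j'})$ cross in exactly one point $q$; say that the segment $x_ix_j$ is \emph{above} $x_{i'}x_{j'}$ if the point of $x_ix_j$ lying over $q$ has larger third coordinate than the point of $x_{i'}x_{j'}$ lying over $q$, and \emph{below} otherwise. For $k\ge 4$, let $\operatorname{AB}(k)$ be the smallest integer $N$ such that every such sequence $x_1,\dots,x_N$ contains indices $1\le i_1<\cdots<i_k\le N$ for which either $x_{i_r}x_{i_t}$ is above $x_{i_s}x_{i_u}$ for all $1\le r<s<t<u\le k$, or $x_{i_r}x_{i_t}$ is below $x_{i_s}x_{i_u}$ for all $1\le r<s<t<u\le k$. Then there exist absolute constants $c,C>0$ such that for all $k\ge 4$, \[ 2^{2^{ck}}\le \operatorname{AB}(k)\le 2^{2^{Ck}}. \] *)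

theory Defs
  imports "HOL-Analysis.Analysis"
begin

definition proj :: "real^3 \<Rightarrow> real^2" where
  "proj x = vector [x $ 1, x $ 2]"

(* Imposed on index sets, so it also excludes coinciding points when N \<ge> 4. Non-collinearity
   of triples needs no clause: it follows from convex_polygon_vertices for the projections. *)
definition general_position :: "nat \<Rightarrow> (nat \<Rightarrow> real^3) \<Rightarrow> bool" where
  "general_position N x \<longleftrightarrow> (\<forall>I\<subseteq>{1..N}. card I = 4 \<longrightarrow> \<not> coplanar (x ` I))"

(* p 1, ..., p N are all the vertices of the polygon P, listed in their cyclic order along the
   boundary; both orientations are allowed. *)
definition convex_polygon_vertices :: "nat \<Rightarrow> (nat \<Rightarrow> real^2) \<Rightarrow> bool" where
  "convex_polygon_vertices N p \<longleftrightarrow>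
     N \<ge> 3 \<and> inj_on p {1..N} \<and>
     (\<exists>P. polytope P \<and> aff_dim P = 2 \<and>
          {v. v extreme_point_of P} = p ` {1..N} \<and>
          (\<forall>i\<in>{1..<N}. closed_segment (p i) (p (Suc i)) edge_of P) \<and>
          closed_segment (p N) (p 1) edge_of P)"

definition admissible :: "nat \<Rightarrow> (nat \<Rightarrow> real^3) \<Rightarrow> bool" where
  "admissible N x \<longleftrightarrow>
     general_position N x \<and> convex_polygon_vertices N (\<lambda>i. proj (x i))"

(* Used only when the projected segments cross in exactly one point q and are nondegenerate;
   then u and v are the unique points of ab and cd over q. *)
definition above :: "real^3 \<Rightarrow> real^3 \<Rightarrow> real^3 \<Rightarrow> real^3 \<Rightarrow> bool" where
  "above a b c d \<longleftrightarrow>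
     (\<exists>q u v. q \<in> closed_segment (proj a) (proj b) \<inter> closed_segment (proj c) (proj d) \<and>
              u \<in> closed_segment a b \<and> proj u = q \<and>
              v \<in> closed_segment c d \<and> proj v = q \<and>
              u $ 3 > v $ 3)"

definition below :: "real^3 \<Rightarrow> real^3 \<Rightarrow> real^3 \<Rightarrow> real^3 \<Rightarrow> bool" where
  "below a b c d \<longleftrightarrow> \<not> above a b c d"

definition has_AB_subsequence :: "nat \<Rightarrow> nat \<Rightarrow> (nat \<Rightarrow> real^3) \<Rightarrow> bool" where
  "has_AB_subsequence k N x \<longleftrightarrow>
     (\<exists>i. strict_mono_on {1..k} i \<and> i ` {1..k} \<subseteq> {1..N} \<and>
        ((\<forall>r s t u. 1 \<le> r \<and> r < s \<and> s < t \<and> t < u \<and> u \<le> k \<longrightarrow>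
            above (x (i r)) (x (i t)) (x (i s)) (x (i u))) \<or>
         (\<forall>r s t u. 1 \<le> r \<and> r < s \<and> s < t \<and> t < u \<and> u \<le> k \<longrightarrow>
            below (x (i r)) (x (i t)) (x (i s)) (x (i u)))))"

(* N \<ge> 3 because a polygon has at least three vertices: for N < 3 there are no admissible
   sequences, and the condition would hold vacuously. *)
definition AB_good :: "nat \<Rightarrow> nat \<Rightarrow> bool" where
  "AB_good k N \<longleftrightarrow> N \<ge> 3 \<and> (\<forall>x. admissible N x \<longrightarrow> has_AB_subsequence k N x)"

(* Meaningful only if some N satisfies AB_good k N. *)
definition AB :: "nat \<Rightarrow> nat" where
  "AB k = (LEAST N. AB_good k N)"

end

theory Submission
  imports Defs
begin

text \<open>Whether one segment lies above the other is the sign of a \<open>4 \<times> 4\<close> determinant.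

  Upper bound: among five points, the Grassmann--Pluecker relations make the colouring transitive
  (if \<open>abcd\<close> and \<open>bcde\<close> have the same colour, so do all five quadruples), hence a monochromatic
  tight path already spans a monochromatic set. Labelling each triple by the lengths of the
  longest paths ending there bounds the number of points without long paths by
  the number of sets of up-sets of an \<open>n \<times> n\<close> grid.

  Lower bound: lift points of the parabola, so that the sign becomes that of a third divided
  difference. The points are binary strings of length \<open>m = 2 ^ h\<close>, bit \<open>l\<close> shifting by a vector of
  length scale \<open>w l\<close> and slope \<open>u l\<close>. For rapidly growing \<open>w\<close> the sign for four consecutive points
  depends only on the three top bits in which neighbours differ: a local maximum gives \<open>+\<close>, a local
  minimum gives \<open>-\<close>, and on a monotone triple the sign compares second divided differences of the
  slopes, which \<open>u\<close> is chosen to make depend on the binary expansions of the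
  bit positions themselves. So a homogeneous set has at most \<open>2 h + 2\<close> points.\<close>

section \<open>Orientations and convex polygons\<close>

definition orient2 :: "real^2 \<Rightarrow> real^2 \<Rightarrow> real^2 \<Rightarrow> real" where
  "orient2 p q r = (q$1 - p$1) * (r$2 - p$2) - (q$2 - p$2) * (r$1 - p$1)"

text \<open>Up to sign, the determinant with rows \<open>(1, x, y, z)\<close>, expanded along the
  height column. This form keeps visible the planar minors, whose signs are known in convex
  position.\<close>

definition orient3 :: "real^3 \<Rightarrow> real^3 \<Rightarrow> real^3 \<Rightarrow> real^3 \<Rightarrow> real" where
  "orient3 a b c d =
     orient2 (proj b) (proj c) (proj d) * a$3 - orient2 (proj a) (proj c) (proj d) * b$3
   + orient2 (proj a) (proj b) (proj d) * c$3 - orient2 (proj a) (proj b) (proj c) * d$3"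

lemma proj_nth [simp]: "proj x $ 1 = x $ 1" "proj x $ 2 = x $ 2"
  by (simp_all add: proj_def)

lemma proj_eq_iff: "proj x = proj y \<longleftrightarrow> x $ 1 = y $ 1 \<and> x $ 2 = y $ 2"
  by (simp add: vec_eq_iff forall_2)

text \<open>Three-term Grassmann-Pluecker relations: a planar orientation is the spatial determinant
  whose fourth point is the vertical direction at infinity. Each right side combines the quadruples
  \<open>abcd\<close> and \<open>bcde\<close>, with planar coefficients of one sign in convex
  position.\<close>

lemma orient3_exchange:
  fixes a b c d e :: "real^3"
  defines "o2 \<equiv> \<lambda>p q r. orient2 (proj p) (proj q) (proj r)"
  shows "orient3 a c d e * o2 b c d = orient3 b c d e * o2 a c d + orient3 a b c d * o2 c d e"
    and "orient3 a b d e * o2 b c d = orient3 b c d e * o2 a b d + orient3 a b c d * o2 b d e"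
    and "orient3 a b c e * o2 b c d = orient3 b c d e * o2 a b c + orient3 a b c d * o2 b c e"
  unfolding o2_def orient3_def orient2_def proj_nth by algebra+

text \<open>Cramer's rule; the common factor is twice the signed area of the quadrilateral
  \<open>abcd\<close>, cut along \<open>bd\<close>.\<close>

lemma crossing_coefficients:
  fixes a b c d :: "real^2"
  assumes eq: "(1 - \<alpha>) *\<^sub>R a + \<alpha> *\<^sub>R c = (1 - \<beta>) *\<^sub>R b + \<beta> *\<^sub>R d"
  shows "\<alpha> * (orient2 b c d + orient2 a b d) = orient2 a b d"
    and "\<beta> * (orient2 b c d + orient2 a b d) = orient2 a b c"
proof -
  have e1: "(1 - \<alpha>) * a$1 + \<alpha> * c$1 = (1 - \<beta>) * b$1 + \<beta> * d$1"
    using arg_cong[OF eq, of "\<lambda>v. v $ 1"] by simp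
  have e2: "(1 - \<alpha>) * a$2 + \<alpha> * c$2 = (1 - \<beta>) * b$2 + \<beta> * d$2"
    using arg_cong[OF eq, of "\<lambda>v. v $ 2"] by simp
  show "\<alpha> * (orient2 b c d + orient2 a b d) = orient2 a b d"
    using e1 e2 unfolding orient2_def by algebra
  show "\<beta> * (orient2 b c d + orient2 a b d) = orient2 a b c"
    using e1 e2 unfolding orient2_def by algebra
qed

text \<open>At the crossing point the difference of heights times \<Sigma> equals
  \<open>orient3\<close>. The factor \<open>s\<close> admits both orientations of the
  polygon.\<close>

lemma above_iff_orient3:
  fixes a b c d :: "real^3"
  assumes pos: "s * orient2 (proj a) (proj b) (proj c) > 0" "s * orient2 (proj a) (proj b) (proj d) > 0"
    "s * orient2 (proj a) (proj c) (proj d) > 0" "s * orient2 (proj b) (proj c) (proj d) > 0"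
  shows "above a c b d \<longleftrightarrow> s * orient3 a b c d > 0"
proof -
  define A B C D where "A = orient2 (proj b) (proj c) (proj d)" and "B = orient2 (proj a) (proj c) (proj d)"
    and "C = orient2 (proj a) (proj b) (proj d)" and "D = orient2 (proj a) (proj b) (proj c)"
  define \<Sigma> where "\<Sigma> = A + C"
  \<comment> \<open>Either diagonal cuts the quadrilateral into two triangles of the same total
    area.\<close>
  have sum: "A + C = B + D"
    unfolding A_def B_def C_def D_def orient2_def by algebra
  have pos': "s * A > 0" "s * B > 0" "s * C > 0" "s * D > 0"
    using pos by (auto simp: A_def B_def C_def D_def)
  then have sS: "s * \<Sigma> > 0" by (simp add: \<Sigma>_def distrib_left)
  then have S0: "\<Sigma> \<noteq> 0" by auto
  have s0: "s \<noteq> 0" using sS by auto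
  have diff: "\<Sigma> * (((1 - \<alpha>) *\<^sub>R a + \<alpha> *\<^sub>R c) $ 3 - ((1 - \<beta>) *\<^sub>R b + \<beta> *\<^sub>R d) $ 3) = orient3 a b c d"
    if "\<alpha> * \<Sigma> = C" "\<beta> * \<Sigma> = D" for \<alpha> \<beta>
  proof -
    have "orient3 a b c d = A * a$3 - B * b$3 + C * c$3 - D * d$3"
      by (simp add: orient3_def A_def B_def C_def D_def)
    moreover have "A = \<Sigma> - C" "B = \<Sigma> - D" using sum by (auto simp: \<Sigma>_def)
    ultimately show ?thesis using that unfolding vector_add_component vector_scaleR_component real_scaleR_def by algebra
  qed
  have sgn: "s * (\<Sigma> * r) > 0 \<longleftrightarrow> r > 0" for r
    using zero_less_mult_pos[OF _ sS, of r] mult_pos_pos[OF sS, of r] by (metis mult.assoc mult.commute)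
  show ?thesis
  proof
    assume "above a c b d"
    then obtain u v where uv: "u \<in> closed_segment a c" "v \<in> closed_segment b d"
      "proj u = proj v" "u $ 3 > v $ 3"
      unfolding above_def by auto
    obtain \<alpha> where u: "u = (1 - \<alpha>) *\<^sub>R a + \<alpha> *\<^sub>R c" using uv(1) by (auto simp: in_segment)
    obtain \<beta> where v: "v = (1 - \<beta>) *\<^sub>R b + \<beta> *\<^sub>R d" using uv(2) by (auto simp: in_segment)
    have "(1 - \<alpha>) *\<^sub>R proj a + \<alpha> *\<^sub>R proj c = (1 - \<beta>) *\<^sub>R proj b + \<beta> *\<^sub>R proj d"
      using uv(3) by (simp add: u v vec_eq_iff forall_2)
    from crossing_coefficients[OF this]
    have "\<alpha> * \<Sigma> = C" "\<beta> * \<Sigma> = D" by (auto simp: \<Sigma>_def A_def C_def D_def)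
    from diff[OF this] uv(4) show "s * orient3 a b c d > 0"
      using sgn[of "u $ 3 - v $ 3"] by (simp add: u v)
  next
    assume h: "s * orient3 a b c d > 0"
    define \<alpha> \<beta> where "\<alpha> = C / \<Sigma>" and "\<beta> = D / \<Sigma>"
    have ab: "\<alpha> * \<Sigma> = C" "\<beta> * \<Sigma> = D" using S0 by (auto simp: \<alpha>_def \<beta>_def)
    have a: "\<alpha> = (s * C) / (s * \<Sigma>)" and b: "\<beta> = (s * D) / (s * \<Sigma>)"
      using s0 by (auto simp: \<alpha>_def \<beta>_def)
    have "s * \<Sigma> = s * A + s * C" "s * \<Sigma> = s * B + s * D"
      using sum by (simp_all add: \<Sigma>_def flip: distrib_left)
    then have "s * C \<le> s * \<Sigma>" "s * D \<le> s * \<Sigma>" using pos' by linarith+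
    then have in01: "0 \<le> \<alpha>" "\<alpha> \<le> 1" "0 \<le> \<beta>" "\<beta> \<le> 1"
      unfolding a b divide_le_eq_1_pos[OF sS] using pos' sS by (auto simp only: intro!: divide_nonneg_pos elim: less_imp_le)
    define u v where "u = (1 - \<alpha>) *\<^sub>R a + \<alpha> *\<^sub>R c" and "v = (1 - \<beta>) *\<^sub>R b + \<beta> *\<^sub>R d"
    have "\<Sigma> * (u $ 1) = \<Sigma> * (v $ 1)" "\<Sigma> * (u $ 2) = \<Sigma> * (v $ 2)"
    proof -
      have 1: "\<Sigma> * (u $ i) = A * a$i + C * c$i" "\<Sigma> * (v $ i) = B * b$i + D * d$i" for i
      proof -
        have "\<Sigma> * (u $ i) = (\<Sigma> - \<alpha> * \<Sigma>) * a$i + (\<alpha> * \<Sigma>) * c$i"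
          by (simp add: u_def algebra_simps)
        then show "\<Sigma> * (u $ i) = A * a$i + C * c$i" by (simp add: ab) (simp add: \<Sigma>_def)
        have "\<Sigma> * (v $ i) = (\<Sigma> - \<beta> * \<Sigma>) * b$i + (\<beta> * \<Sigma>) * d$i"
          by (simp add: v_def algebra_simps)
        then show "\<Sigma> * (v $ i) = B * b$i + D * d$i" by (simp add: ab) (simp add: \<Sigma>_def sum)
      qed
      have "A * a$1 + C * c$1 = B * b$1 + D * d$1" "A * a$2 + C * c$2 = B * b$2 + D * d$2"
        unfolding A_def B_def C_def D_def orient2_def proj_nth by algebra+
      then show "\<Sigma> * (u $ 1) = \<Sigma> * (v $ 1)" "\<Sigma> * (u $ 2) = \<Sigma> * (v $ 2)" unfolding 1 by auto
    qed
    then have puv: "proj u = proj v" using S0 by (auto simp: proj_eq_iff)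
    have "u $ 3 > v $ 3" using h diff[OF ab] sgn[of "u$3 - v$3"] by (simp add: u_def v_def)
    moreover have "u \<in> closed_segment a c" "v \<in> closed_segment b d"
      using in01 by (auto simp: in_segment u_def v_def)
    moreover have "proj u \<in> closed_segment (proj a) (proj c)"
      unfolding in_segment using in01 by (intro exI[of _ \<alpha>]) (auto simp: u_def vec_eq_iff forall_2)
    moreover have "proj v \<in> closed_segment (proj b) (proj d)"
      unfolding in_segment using in01 by (intro exI[of _ \<beta>]) (auto simp: v_def vec_eq_iff forall_2)
    ultimately show "above a c b d" unfolding above_def using puv by auto
  qed
qed

section \<open>Consistent orientation of convex polygons\<close>

text \<open>An edge is an exposed face, so some linear functional is maximal exactly on it and
  smaller at all other vertices; in the plane, \<open>orient2 p q\<close> is a multiple of its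
  deficit.\<close>

lemma edge_same_side:
  assumes P: "polytope P" and ext: "{v. v extreme_point_of P} = V"
    and e: "closed_segment p q edge_of P" and pq: "p \<noteq> q"
  obtains s :: real where "s = 1 \<or> s = -1" "\<And>v. v \<in> V \<Longrightarrow> v \<noteq> p \<Longrightarrow> v \<noteq> q \<Longrightarrow> s * orient2 p q v > 0"
proof -
  have face: "closed_segment p q face_of P" using e by (simp add: edge_of_def)
  then have "closed_segment p q exposed_face_of P"
    using P exposed_face_of_polyhedron polytope_imp_polyhedron by blast
  then obtain a b where ab: "P \<subseteq> {x. a \<bullet> x \<le> b}" "closed_segment p q = P \<inter> {x. a \<bullet> x = b}"
    unfolding exposed_face_of_def by blast
  have apq: "a \<bullet> p = b" "a \<bullet> q = b" using ab(2) by auto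
  have strict: "a \<bullet> v < b" if "v \<in> V" "v \<noteq> p" "v \<noteq> q" for v
  proof -
    have ev: "v extreme_point_of P" using that ext by auto
    then have "v \<in> P" by (simp add: extreme_point_of_def)
    moreover have "p \<in> P" "q \<in> P" using ab(2) by auto
    then have "v \<notin> closed_segment p q"
      using ev that by (auto simp: extreme_point_of_def open_segment_def)
    ultimately show ?thesis using ab by force
  qed
  \<comment> \<open>The cross product of the normal \<open>a\<close> with the edge direction; its
    sign tells on which side of the edge the polygon lies.\<close>
  define \<mu> where "\<mu> = (q$2 - p$2) * a$1 - (q$1 - p$1) * a$2"
  have perp: "a$1 * (q$1 - p$1) + a$2 * (q$2 - p$2) = 0"
    using apq by (simp add: inner_vec_def sum_2 algebra_simps)
  have key: "orient2 p q v * (a$1 * a$1 + a$2 * a$2) = \<mu> * (b - a \<bullet> v)" for v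
  proof -
    have "b - a \<bullet> v = a$1 * (p$1 - v$1) + a$2 * (p$2 - v$2)"
      using apq(1) by (simp add: inner_vec_def sum_2 algebra_simps)
    then show ?thesis using perp unfolding orient2_def \<mu>_def by algebra
  qed
  show ?thesis
  proof (cases "V \<subseteq> {p, q}")
    case True
    then show ?thesis using that[of 1] by auto
  next
    case False
    then obtain v where "v \<in> V" "v \<noteq> p" "v \<noteq> q" by auto
    then have "a \<noteq> 0" using strict[of v] apq by auto
    then have "a$1 \<noteq> 0 \<or> a$2 \<noteq> 0" by (simp add: vec_eq_iff forall_2)
    then have apos: "a$1 * a$1 + a$2 * a$2 > 0" by (simp add: sum_squares_gt_zero_iff)
    have "\<mu> \<noteq> 0"
    proof
      assume "\<mu> = 0"
      then have "(a$1 * a$1 + a$2 * a$2) * (q$1 - p$1) = 0" "(a$1 * a$1 + a$2 * a$2) * (q$2 - p$2) = 0"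
        using perp unfolding \<mu>_def by algebra+
      then have "q$1 = p$1" "q$2 = p$2" using apos by auto
      then show False using pq by (simp add: vec_eq_iff forall_2)
    qed
    have pos: "sgn \<mu> * orient2 p q v > 0" if "v \<in> V" "v \<noteq> p" "v \<noteq> q" for v
    proof -
      have "(sgn \<mu> * orient2 p q v) * (a$1 * a$1 + a$2 * a$2) = \<bar>\<mu>\<bar> * (b - a \<bullet> v)"
        using key[of v] by (simp add: mult.assoc abs_sgn mult.commute)
      also have "\<dots> > 0" using strict[OF that] \<open>\<mu> \<noteq> 0\<close> by simp
      finally show ?thesis using apos by (simp add: zero_less_mult_iff)
    qed
    show ?thesis using \<open>\<mu> \<noteq> 0\<close> pos that[of "sgn \<mu>"] by (auto simp: sgn_real_def split: if_splits)
  qed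
qed

text \<open>Consecutive edges share a triple of vertices, which forces their signs to agree. For
  \<open>i < j < k\<close>, an induction on \<open>k\<close> then fans out from
  \<open>p i\<close>.\<close>

lemma convex_polygon_orientation:
  assumes "convex_polygon_vertices N p"
  obtains s :: real where
    "\<And>i j k. 1 \<le> i \<Longrightarrow> i < j \<Longrightarrow> j < k \<Longrightarrow> k \<le> N \<Longrightarrow> s * orient2 (p i) (p j) (p k) > 0"
proof -
  have inj: "inj_on p {1..N}" and N: "N \<ge> 3" using assms by (auto simp: convex_polygon_vertices_def)
  obtain P where P: "polytope P" "{v. v extreme_point_of P} = p ` {1..N}"
    and e: "\<And>i. i \<in> {1..<N} \<Longrightarrow> closed_segment (p i) (p (Suc i)) edge_of P"
    using assms unfolding convex_polygon_vertices_def by blast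
  have "\<exists>s::real. (s = 1 \<or> s = -1) \<and> (\<forall>j\<in>{1..N}. j \<noteq> i \<longrightarrow> j \<noteq> Suc i \<longrightarrow> s * orient2 (p i) (p (Suc i)) (p j) > 0)"
    if "i \<in> {1..<N}" for i
  proof -
    have ne: "p i \<noteq> p (Suc i)" using inj that by (auto dest: inj_onD)
    from edge_same_side[OF P e[OF that] ne] obtain s :: real where s: "s = 1 \<or> s = -1"
      "\<And>v. v \<in> p ` {1..N} \<Longrightarrow> v \<noteq> p i \<Longrightarrow> v \<noteq> p (Suc i) \<Longrightarrow> s * orient2 (p i) (p (Suc i)) v > 0"
      by blast
    then show ?thesis using that inj by (intro exI[of _ s]) (auto simp: inj_on_eq_iff)
  qed
  then obtain s :: "nat \<Rightarrow> real" where s1: "\<And>i. i \<in> {1..<N} \<Longrightarrow> s i = 1 \<or> s i = -1"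
    and s2: "\<And>i j. i \<in> {1..<N} \<Longrightarrow> j \<in> {1..N} \<Longrightarrow> j \<noteq> i \<Longrightarrow> j \<noteq> Suc i \<Longrightarrow> s i * orient2 (p i) (p (Suc i)) (p j) > 0"
    by metis
  have step: "s (Suc i) = s i" if "1 \<le> i" "Suc i < N" for i
  proof -
    have "s i * orient2 (p i) (p (Suc i)) (p (Suc (Suc i))) > 0"
      using s2[of i "Suc (Suc i)"] that by auto
    moreover have "s (Suc i) * orient2 (p (Suc i)) (p (Suc (Suc i))) (p i) > 0"
      using s2[of "Suc i" i] that by auto
    moreover have "orient2 (p (Suc i)) (p (Suc (Suc i))) (p i) = orient2 (p i) (p (Suc i)) (p (Suc (Suc i)))"
      by (simp add: orient2_def algebra_simps)
    ultimately show ?thesis using s1[of i] s1[of "Suc i"] that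
      by (auto simp: )
  qed
  have s_eq: "s i = s 1" if "1 \<le> i" "i < N" for i
    using that by (induction i rule: dec_induct) (auto simp: step)
  define \<sigma> where "\<sigma> = s 1"
  have edge: "\<sigma> * orient2 (p i) (p (Suc i)) (p j) > 0"
    if "1 \<le> i" "i < N" "1 \<le> j" "j \<le> N" "j \<noteq> i" "j \<noteq> Suc i" for i j
    using s2[of i j] s_eq[of i] that by (auto simp: \<sigma>_def)
  have sq: "\<sigma> * \<sigma> = 1" using s1[of 1] N by (auto simp: \<sigma>_def)
  have "\<sigma> * orient2 (p i) (p j) (p k) > 0" if "1 \<le> i" "i < j" "j < k" "k \<le> N" for i j k
    using Suc_leI[OF that(3)] that(4)
  proof (induction k rule: dec_induct)
    case base
    then show ?case using edge[of j i] that by (simp add: orient2_def algebra_simps)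
  next
    case (step k)
    define u a b c where "u = p (Suc i)" "a = p j" "b = p k" "c = p (Suc k)"
    have bc: "\<sigma> * orient2 (p i) b c > 0"
      using edge[of k i] that step by (simp add: orient2_def algebra_simps u_a_b_c_def)
    have ab: "\<sigma> * orient2 (p i) a b > 0" using step by (simp add: u_a_b_c_def)
    show ?case
    proof (cases "j = Suc i")
      case True
      then show ?thesis using edge[of i "Suc k"] that step by auto
    next
      case False
      have uabc: "\<sigma> * orient2 (p i) u a > 0" "\<sigma> * orient2 (p i) u b > 0" "\<sigma> * orient2 (p i) u c > 0"
        using edge[of i j] edge[of i k] edge[of i "Suc k"] that step False
        by (auto simp: u_a_b_c_def)
      \<comment> \<open>Three-term relation for the directions from \<open>p i\<close> to
        \<open>u\<close>, \<open>a\<close>, \<open>b\<close>, \<open>c\<close>; all signs but that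
        of \<open>orient2 (p i) a c\<close> are known.\<close>
      have "orient2 (p i) u b * orient2 (p i) a c =
        orient2 (p i) u a * orient2 (p i) b c + orient2 (p i) u c * orient2 (p i) a b"
        unfolding orient2_def by algebra
      then have "(\<sigma> * orient2 (p i) u b) * (\<sigma> * orient2 (p i) a c) =
        (\<sigma> * orient2 (p i) u a) * (\<sigma> * orient2 (p i) b c) + (\<sigma> * orient2 (p i) u c) * (\<sigma> * orient2 (p i) a b)"
        using sq by algebra
      also have "\<dots> > 0" using uabc ab bc by (simp add: add_pos_pos)
      finally have "\<sigma> * orient2 (p i) a c > 0" using uabc(2) by (rule zero_less_mult_pos)
      then show ?thesis unfolding u_a_b_c_def .
    qed
  qed
  then show ?thesis using that by blast
qed

section \<open>Polygons inscribed in a parabola\<close>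

text \<open>Every face of a polytope is the hull of some of the generating points, and those
  generating this one lie on the hyperplane.\<close>

lemma convex_hull_Int_supporting_hyperplane:
  fixes S :: "'a::euclidean_space set"
  assumes "finite S" "\<And>x. x \<in> S \<Longrightarrow> a \<bullet> x \<le> b"
  shows "convex hull (S \<inter> {x. a \<bullet> x = b}) face_of convex hull S"
proof -
  have sub: "convex hull S \<subseteq> {x. a \<bullet> x \<le> b}"
    using assms(2) by (intro hull_minimal convex_halfspace_le) auto
  define F where "F = convex hull S \<inter> {x. a \<bullet> x = b}"
  have face: "F face_of convex hull S"
    unfolding F_def using sub by (intro face_of_Int_supporting_hyperplane_le convex_convex_hull) auto
  then obtain S' where S': "S' \<subseteq> S" "F = convex hull S'"
    using face_of_convex_hull_subset finite_imp_compact[OF assms(1)] by blast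
  have "S' \<subseteq> S \<inter> {x. a \<bullet> x = b}"
    using S' hull_subset[of S' convex] by (auto simp: F_def)
  then have "F \<subseteq> convex hull (S \<inter> {x. a \<bullet> x = b})"
    unfolding S'(2) by (rule hull_mono)
  moreover have "convex hull (S \<inter> {x. a \<bullet> x = b}) \<subseteq> F"
    unfolding F_def using hull_subset[of S convex]
    by (intro hull_minimal convex_Int convex_convex_hull convex_hyperplane) auto
  ultimately show ?thesis using face by (metis subset_antisym)
qed

text \<open>Relative to the chord through parameters \<open>t i\<close> and \<open>t j\<close>, the
  point with parameter \<open>t m\<close> lies on the side given by the sign of
  \<open>(t m - t i) * (t m - t j)\<close>. Over all \<open>m\<close> this never changes sign for
  neighbouring indices or for the pair \<open>1\<close>, \<open>N\<close>.\<close>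

lemma parabola_polygon:
  fixes t :: "nat \<Rightarrow> real"
  assumes N: "N \<ge> 3" and t: "strict_mono_on {1..N} t"
  shows "convex_polygon_vertices N (\<lambda>i. vector [t i, (t i)\<^sup>2])"
proof -
  define p :: "nat \<Rightarrow> real^2" where "p i = vector [t i, (t i)\<^sup>2]" for i
  have p_nth [simp]: "p i $ 1 = t i" "p i $ 2 = (t i)\<^sup>2" for i by (simp_all add: p_def)
  have inner_p: "a \<bullet> p i = a $ 1 * t i + a $ 2 * (t i)\<^sup>2" for a i
    by (simp add: inner_vec_def sum_2)
  have t_less: "t i < t j" if "i \<in> {1..N}" "j \<in> {1..N}" "i < j" for i j
    using t that by (auto simp: strict_mono_on_def)
  have t_le: "t i \<le> t j" if "i \<in> {1..N}" "j \<in> {1..N}" "i \<le> j" for i j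
    using t_less[of i j] that by (cases "i = j") auto
  have t_inj: "t i = t j \<longleftrightarrow> i = j" if "i \<in> {1..N}" "j \<in> {1..N}" for i j
    using t_less[of i j] t_less[of j i] that by (cases i j rule: linorder_cases) auto
  have p_eq: "p i = p j \<longleftrightarrow> i = j" if "i \<in> {1..N}" "j \<in> {1..N}" for i j
    using t_inj[OF that] by (metis p_nth(1))
  have inj: "inj_on p {1..N}" by (auto intro!: inj_onI simp: p_eq)
  define V where "V = p ` {1..N}"
  have fin: "finite V" by (simp add: V_def)
  have face: "convex hull {p i, p j} face_of convex hull V"
    if ij: "i \<in> {1..N}" "j \<in> {1..N}" and c: "c = 1 \<or> c = -1"
      and side: "\<And>m. m \<in> {1..N} \<Longrightarrow> c * ((t m - t i) * (t m - t j)) \<ge> 0" for i j c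
  proof -
    define a :: "real^2" where "a = vector [c * (t i + t j), - c]"
    have eq: "a \<bullet> p m = c * (t i * t j) - c * ((t m - t i) * (t m - t j))" for m
      by (simp add: inner_p a_def power2_eq_square algebra_simps)
    have "V \<inter> {x. a \<bullet> x = c * (t i * t j)} = {p i, p j}"
      using c ij t_inj by (auto simp: V_def eq)
    moreover have "convex hull (V \<inter> {x. a \<bullet> x = c * (t i * t j)}) face_of convex hull V"
      using side by (intro convex_hull_Int_supporting_hyperplane fin) (auto simp: V_def eq)
    ultimately show ?thesis by simp
  qed
  have edge: "closed_segment (p i) (p j) edge_of convex hull V"
    if ij: "i \<in> {1..N}" "j \<in> {1..N}" "i \<noteq> j" and c: "c = 1 \<or> c = -1"
      and side: "\<And>m. m \<in> {1..N} \<Longrightarrow> c * ((t m - t i) * (t m - t j)) \<ge> 0" for i j c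
    using face[OF ij(1,2) c side] ij p_eq[OF ij(1,2)]
    by (simp add: edge_of_def segment_convex_hull aff_dim_convex_hull)
  have ext: "{v. v extreme_point_of convex hull V} = V"
  proof
    show "{v. v extreme_point_of convex hull V} \<subseteq> V"
      using extreme_point_of_convex_hull by auto
    \<comment> \<open>For \<open>i = j\<close> the chord degenerates to the tangent, which exhibits
      the point as a vertex.\<close>
    have "p i extreme_point_of convex hull V" if "i \<in> {1..N}" for i
      using face[OF that that, of 1] by (simp add: face_of_singleton)
    then show "V \<subseteq> {v. v extreme_point_of convex hull V}" by (auto simp: V_def)
  qed
  \<comment> \<open>A line meets the parabola at most twice, so three of the points already span the
    plane.\<close>
  have "aff_dim V = 2"
  proof (rule ccontr)
    assume "aff_dim V \<noteq> 2"
    then have "aff_dim V < int (DIM(real^2))" using aff_dim_le_DIM[of V] by auto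
    then obtain a b where a: "a \<noteq> 0" "V \<subseteq> {x. a \<bullet> x = b}" by (rule aff_lowdim_subset_hyperplane)
    have ab: "a $ 1 * t i + a $ 2 * (t i)\<^sup>2 = b" if "i \<in> {1..N}" for i
    proof -
      have "p i \<in> {x. a \<bullet> x = b}" using a(2) that unfolding V_def by blast
      then show ?thesis by (simp add: inner_p)
    qed
    have e: "a$1 * t 1 + a$2 * (t 1)\<^sup>2 = b" "a$1 * t 2 + a$2 * (t 2)\<^sup>2 = b" "a$1 * t 3 + a$2 * (t 3)\<^sup>2 = b"
      using N by (auto intro!: ab)
    have l: "t 1 < t 2" "t 2 < t 3" using N by (auto intro!: t_less)
    have "(a$1 + a$2 * (t 1 + t 2)) * (t 2 - t 1) = 0" "(a$1 + a$2 * (t 2 + t 3)) * (t 3 - t 2) = 0"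
      using e by (simp_all add: algebra_simps power2_eq_square)
    then have s: "a$1 + a$2 * (t 1 + t 2) = 0" "a$1 + a$2 * (t 2 + t 3) = 0" using l by simp_all
    then have "a$2 * (t 3 - t 1) = 0" by algebra
    then have a2: "a$2 = 0" using l by simp
    then have "a$1 = 0" using s by simp
    then show False using a(1) a2 by (simp add: vec_eq_iff forall_2)
  qed
  then have "aff_dim (convex hull V) = 2" by (simp add: aff_dim_convex_hull)
  moreover have "polytope (convex hull V)" using fin by (simp add: polytope_convex_hull)
  moreover have "closed_segment (p i) (p (Suc i)) edge_of convex hull V" if "i \<in> {1..<N}" for i
  proof (rule edge[where c = 1])
    fix m assume m: "m \<in> {1..N}"
    show "0 \<le> 1 * ((t m - t i) * (t m - t (Suc i)))"
    proof (cases "m \<le> i")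
      case True
      then show ?thesis using t_le[of m i] t_le[of m "Suc i"] m that by (simp add: mult_nonpos_nonpos)
    next
      case False
      then show ?thesis using t_le[of i m] t_le[of "Suc i" m] m that by simp
    qed
  qed (use that in auto)
  moreover have "closed_segment (p N) (p 1) edge_of convex hull V"
  proof (rule edge[where c = "-1"])
    fix m assume m: "m \<in> {1..N}"
    then have "(t m - t N) * (t m - t 1) \<le> 0"
      using t_le[of m N] t_le[of 1 m] by (intro mult_nonpos_nonneg) auto
    then show "0 \<le> -1 * ((t m - t N) * (t m - t 1))" by simp
  qed (use N in auto)
  ultimately have "convex_polygon_vertices N p"
    unfolding convex_polygon_vertices_def using N inj ext by (auto simp: V_def)
  then show ?thesis by (simp add: p_def[abs_def])
qed

section \<open>Coplanarity and divided differences of lifted points\<close>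

text \<open>The nonzero planar orientation keeps the plane through the points from being vertical;
  on it the height is an affine function, for which \<open>orient3\<close> vanishes.\<close>

lemma coplanar_orient3:
  fixes a b c d :: "real^3"
  assumes "coplanar {a, b, c, d}" "orient2 (proj a) (proj b) (proj c) \<noteq> 0"
  shows "orient3 a b c d = 0"
proof -
  obtain u v w where uvw: "{a, b, c, d} \<subseteq> affine hull {u, v, w}"
    using assms(1) unfolding coplanar_def by blast
  have "aff_dim {u, v, w} \<le> int (card {u, v, w}) - 1"
    by (intro aff_dim_le_card) auto
  moreover have "card {u, v, w} \<le> 3" by (simp add: card_insert_if)
  ultimately have "aff_dim (affine hull {u, v, w}) < int DIM(real^3)" by simp
  then obtain n \<beta> where n: "n \<noteq> 0" "affine hull {u, v, w} \<subseteq> {x. n \<bullet> x = \<beta>}"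
    by (rule aff_lowdim_subset_hyperplane)
  have eq: "n$1 * x$1 + n$2 * x$2 + n$3 * x$3 = \<beta>" if "x \<in> {a, b, c, d}" for x
    using uvw n(2) that by (auto simp: inner_vec_def sum_3)
  note e = eq[of a, simplified] eq[of b, simplified] eq[of c, simplified] eq[of d, simplified]
  have z: "n$3 * x$3 = \<beta> - n$1 * x$1 - n$2 * x$2" if "x \<in> {a, b, c, d}" for x
    using eq[OF that] by simp
  have "n $ 3 * orient3 a b c d =
      orient2 (proj b) (proj c) (proj d) * (n$3 * a$3) - orient2 (proj a) (proj c) (proj d) * (n$3 * b$3)
    + orient2 (proj a) (proj b) (proj d) * (n$3 * c$3) - orient2 (proj a) (proj b) (proj c) * (n$3 * d$3)"
    by (simp add: orient3_def algebra_simps)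
  also have "\<dots> = 0"
    unfolding orient2_def proj_nth by (simp add: z) algebra
  finally have "n $ 3 * orient3 a b c d = 0" .
  moreover have "n $ 3 \<noteq> 0"
  proof
    assume n3: "n $ 3 = 0"
    then have "orient2 (proj a) (proj b) (proj c) * n $ 1 = 0" "orient2 (proj a) (proj b) (proj c) * n $ 2 = 0"
      using e unfolding orient2_def proj_nth by algebra+
    then show False using assms(2) n(1) n3 by (simp add: vec_eq_iff forall_3)
  qed
  ultimately show ?thesis by simp
qed

text \<open>The third divided difference without its last division by \<open>t d - t a\<close>,
  which is positive for increasing parameters and does not affect the sign.\<close>

definition third_diff :: "(nat \<Rightarrow> real) \<Rightarrow> (nat \<Rightarrow> real) \<Rightarrow> nat \<Rightarrow> nat \<Rightarrow> nat \<Rightarrow> nat \<Rightarrow> real" where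
  "third_diff t z a b c d =
    (let s = \<lambda>i j. (z j - z i) / (t j - t i)
     in (s c d - s b c) / (t d - t b) - (s b c - s a b) / (t c - t a))"

definition parabola_lift :: "(nat \<Rightarrow> real) \<Rightarrow> (nat \<Rightarrow> real) \<Rightarrow> nat \<Rightarrow> real^3" where
  "parabola_lift t z i = vector [t i, (t i)\<^sup>2, z i]"

lemma proj_lift: "proj (parabola_lift t z i) = vector [t i, (t i)\<^sup>2]"
  by (simp add: proj_def parabola_lift_def)

lemma orient2_lift:
  "orient2 (proj (parabola_lift t z a)) (proj (parabola_lift t z b)) (proj (parabola_lift t z c))
    = (t b - t a) * ((t c - t a) * (t c - t b))"
  unfolding orient2_def proj_lift vector_2 by algebra

text \<open>The factor is the Vandermonde product of the four parameters without
  \<open>t d - t a\<close>, matching the division left out of \<open>third_diff\<close>. Its minus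
  sign makes \<open>above\<close> correspond to a negative difference.\<close>

lemma orient3_lift:
  assumes "t a < t b" "t b < t c" "t c < t d"
  shows "orient3 (parabola_lift t z a) (parabola_lift t z b) (parabola_lift t z c) (parabola_lift t z d)
    = - ((t b - t a) * (t c - t a) * (t c - t b) * (t d - t b) * (t d - t c)) * third_diff t z a b c d"
proof -
  define p q r where "p = (z b - z a) / (t b - t a)" and "q = (z c - z b) / (t c - t b)"
    and "r = (z d - z c) / (t d - t c)"
  have e: "z b = z a + p * (t b - t a)" "z c = z b + q * (t c - t b)" "z d = z c + r * (t d - t c)"
    using assms by (auto simp: p_def q_def r_def)
  have l3: "parabola_lift t z i $ 3 = z i" for i by (simp add: parabola_lift_def)
  have "orient3 (parabola_lift t z a) (parabola_lift t z b) (parabola_lift t z c) (parabola_lift t z d)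
    = - ((t b - t a) * (t c - t b) * (t d - t c)) * ((r - q) * (t c - t a) - (q - p) * (t d - t b))"
    unfolding orient3_def orient2_lift l3 using e by algebra
  moreover have "(r - q) * (t c - t a) - (q - p) * (t d - t b)
     = (t c - t a) * (t d - t b) * third_diff t z a b c d"
  proof -
    have "(r - q) * X - (q - p) * Y = X * Y * ((r - q) / Y - (q - p) / X)" if "X \<noteq> 0" "Y \<noteq> 0" for X Y
      using that by (simp add: field_simps)
    then show ?thesis
      using assms unfolding third_diff_def p_def[symmetric] q_def[symmetric] r_def[symmetric] Let_def by simp
  qed
  ultimately show ?thesis by (simp add: mult_ac)
qed

lemma above_lift_iff:
  assumes "t a < t b" "t b < t c" "t c < t d"
  shows "above (parabola_lift t z a) (parabola_lift t z c) (parabola_lift t z b) (parabola_lift t z d) \<longleftrightarrow> third_diff t z a b c d < 0"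
proof -
  have pos: "(t b - t a) * (t c - t a) * (t c - t b) * (t d - t b) * (t d - t c) > 0"
    using assms by simp
  have neg: "0 < 1 * (- K * D) \<longleftrightarrow> D < 0" if "K > 0" for K D :: real
    using that by (simp add: mult_less_0_iff)
  have "above (parabola_lift t z a) (parabola_lift t z c) (parabola_lift t z b) (parabola_lift t z d) \<longleftrightarrow>
    1 * orient3 (parabola_lift t z a) (parabola_lift t z b) (parabola_lift t z c) (parabola_lift t z d) > 0"
    using assms by (intro above_iff_orient3) (simp_all add: orient2_lift)
  then show ?thesis unfolding orient3_lift[OF assms] neg[OF pos] .
qed

lemma sorted_4_subset:
  fixes I :: "nat set"
  assumes "card I = 4"
  obtains a b c d where "I = {a, b, c, d}" "a < b" "b < c" "c < d"
proof -
  define xs where "xs = sorted_list_of_set I"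
  have fin: "finite I" using assms card.infinite by fastforce
  then have xs: "length xs = 4" "sorted_wrt (<) xs" "set xs = I"
    using assms by (auto simp: xs_def)
  then obtain a b c d where "xs = [a, b, c, d]"
    by (auto simp: length_Suc_conv numeral_eq_Suc)
  then show ?thesis using xs that[of a b c d] by auto
qed

lemma admissible_lift:
  assumes N: "N \<ge> 3" and t: "strict_mono_on {1..N} t"
    and nz: "\<And>a b c d. 1 \<le> a \<Longrightarrow> a < b \<Longrightarrow> b < c \<Longrightarrow> c < d \<Longrightarrow> d \<le> N \<Longrightarrow> third_diff t z a b c d \<noteq> 0"
  shows "admissible N (parabola_lift t z)"
proof -
  have "\<not> coplanar (parabola_lift t z ` I)" if I: "I \<subseteq> {1..N}" "card I = 4" for I
  proof
    assume cop: "coplanar (parabola_lift t z ` I)"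
    obtain a b c d where abcd: "I = {a, b, c, d}" "a < b" "b < c" "c < d"
      using sorted_4_subset[OF I(2)] .
    then have l: "t a < t b" "t b < t c" "t c < t d"
      using t I(1) by (auto simp: strict_mono_on_def)
    then have "orient2 (proj (parabola_lift t z a)) (proj (parabola_lift t z b)) (proj (parabola_lift t z c)) \<noteq> 0"
      by (simp add: orient2_lift)
    then have "orient3 (parabola_lift t z a) (parabola_lift t z b) (parabola_lift t z c) (parabola_lift t z d) = 0"
      using cop by (intro coplanar_orient3) (simp add: abcd)
    then show False using nz[of a b c d] abcd I(1) l by (simp add: orient3_lift)
  qed
  then show ?thesis
    unfolding admissible_def general_position_def proj_lift using parabola_polygon[OF N t] by blast
qed

section \<open>Transitive colourings of quadruples\<close>

text \<open>The value \<open>f p\<close> is the element of the image with exactly \<open>p\<close>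
  smaller elements.\<close>

lemma strict_mono_on_image_unique:
  fixes f g :: "nat \<Rightarrow> nat"
  assumes f: "strict_mono_on {..<n} f" and g: "strict_mono_on {..<n} g"
    and img: "f ` {..<n} = g ` {..<n}" and p: "p < n"
  shows "f p = g p"
proof -
  have count: "card {y \<in> h ` {..<n}. y < h p} = p" if h: "strict_mono_on {..<n} h" for h :: "nat \<Rightarrow> nat"
  proof -
    have "h q < h p \<longleftrightarrow> q < p" if "q < n" for q
      using strict_mono_on_less[OF h, of q p] that p by simp
    then have "{y \<in> h ` {..<n}. y < h p} = h ` {..<p}" using p by auto
    moreover have "inj_on h {..<p}"
      using strict_mono_on_imp_inj_on[OF h] p by (auto intro: inj_on_subset)
    ultimately show ?thesis by (simp add: card_image)
  qed
  have mono: "x = y" if "x \<in> g ` {..<n}" "y \<in> g ` {..<n}"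
    "card {z \<in> g ` {..<n}. z < x} = card {z \<in> g ` {..<n}. z < y}" for x y
  proof (rule ccontr)
    have less: "card {z \<in> g ` {..<n}. z < u} < card {z \<in> g ` {..<n}. z < v}"
      if "u < v" "u \<in> g ` {..<n}" for u v
      using that by (intro psubset_card_mono) auto
    assume "x \<noteq> y"
    then show False using less[of x y] less[of y x] that by (auto simp: neq_iff)
  qed
  show ?thesis
    using mono[of "f p" "g p"] count[OF f] count[OF g] p img by auto
qed

definition upsets :: "nat \<Rightarrow> (nat \<times> nat) set set" where
  "upsets n = {S. S \<subseteq> {..<n} \<times> {..<n} \<and>
     (\<forall>p q p' q'. (p, q) \<in> S \<longrightarrow> p \<le> p' \<longrightarrow> p' < n \<longrightarrow> q \<le> q' \<longrightarrow> q' < n \<longrightarrow> (p', q') \<in> S)}"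

lemma finite_upsets: "finite (upsets n)"
  by (rule finite_subset[of _ "Pow ({..<n} \<times> {..<n})"]) (auto simp: upsets_def)

text \<open>Each row of an up-set is a final segment of \<open>{..<n}\<close>, hence known from its
  length.\<close>

lemma mem_upset_iff:
  assumes S: "S \<in> upsets n" and p: "p < n" and q: "q < n"
  shows "(p, q) \<in> S \<longleftrightarrow> n \<le> q + card {r. (p, r) \<in> S}"
proof -
  have sub: "{r. (p, r) \<in> S} \<subseteq> {..<n}" using S by (auto simp: upsets_def)
  then have fin: "finite {r. (p, r) \<in> S}" by (rule finite_subset) simp
  show ?thesis
  proof
    assume "(p, q) \<in> S"
    then have "{q..<n} \<subseteq> {r. (p, r) \<in> S}" using S p by (auto simp: upsets_def)
    then have "card {q..<n} \<le> card {r. (p, r) \<in> S}" by (rule card_mono[OF fin])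
    then show "n \<le> q + card {r. (p, r) \<in> S}" by simp
  next
    assume h: "n \<le> q + card {r. (p, r) \<in> S}"
    show "(p, q) \<in> S"
    proof (rule ccontr)
      assume "(p, q) \<notin> S"
      moreover have "(p, q) \<in> S" if "(p, r) \<in> S" "r \<le> q" for r
        using S p q that unfolding upsets_def by blast
      ultimately have "{r. (p, r) \<in> S} \<subseteq> {q<..<n}" using sub by (force simp: not_le[symmetric])
      then have "card {r. (p, r) \<in> S} \<le> card {q<..<n}" by (rule card_mono[rotated]) simp
      then show False using h q by simp
    qed
  qed
qed

text \<open>Row lengths grow weakly with \<open>p\<close>; adding \<open>p\<close> makes them
  strictly increasing and below \<open>2 * n\<close>. So up-sets are encoded injectively by subsets
  of a set of size \<open>2 * n\<close>.\<close>

lemma card_upsets_le: "card (upsets n) \<le> 4 ^ n"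
proof -
  define h where "h S p = p + card {r. (p, r) \<in> S}" for S :: "(nat \<times> nat) set" and p
  have row: "{r. (p, r) \<in> S} \<subseteq> {..<n}" if "S \<in> upsets n" for S p
    using that by (auto simp: upsets_def)
  have mono: "strict_mono_on {..<n} (h S)" if S: "S \<in> upsets n" for S
  proof (rule strict_mono_onI)
    fix p p' assume pp: "p \<in> {..<n}" "p' \<in> {..<n}" "p < p'"
    have "{r. (p, r) \<in> S} \<subseteq> {r. (p', r) \<in> S}"
    proof safe
      fix r assume r: "(p, r) \<in> S"
      then have "r < n" using row[OF S, of p] by auto
      then show "(p', r) \<in> S" using S pp r unfolding upsets_def by force
    qed
    then have "card {r. (p, r) \<in> S} \<le> card {r. (p', r) \<in> S}"
      using finite_subset[OF row[OF S]] by (intro card_mono) auto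
    then show "h S p < h S p'" using pp by (simp add: h_def)
  qed
  have "inj_on (\<lambda>S. h S ` {..<n}) (upsets n)"
  proof (rule inj_onI)
    fix S T assume S: "S \<in> upsets n" and T: "T \<in> upsets n" and eq: "h S ` {..<n} = h T ` {..<n}"
    have "h S p = h T p" if "p < n" for p
      using strict_mono_on_image_unique[OF mono[OF S] mono[OF T] eq that] .
    then have "(p, q) \<in> S \<longleftrightarrow> (p, q) \<in> T" if "p < n" "q < n" for p q
      using mem_upset_iff[OF S that] mem_upset_iff[OF T that] that by (simp add: h_def)
    moreover have "S \<subseteq> {..<n} \<times> {..<n}" "T \<subseteq> {..<n} \<times> {..<n}" using S T by (auto simp: upsets_def)
    ultimately show "S = T" by auto
  qed
  moreover have "(\<lambda>S. h S ` {..<n}) ` upsets n \<subseteq> Pow {..<2 * n}"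
  proof safe
    fix S p assume S: "S \<in> upsets n" and p: "p < n"
    have "card {r. (p, r) \<in> S} \<le> card {..<n}" by (intro card_mono row[OF S]) simp
    then show "h S p < 2 * n" using p by (simp add: h_def)
  qed
  ultimately have "card (upsets n) \<le> card (Pow {..<2 * n})"
    by (rule card_inj_on_le) simp
  also have "\<dots> = 4 ^ n" by (simp add: card_Pow power_mult)
  finally show ?thesis .
qed

section \<open>Tight paths and homogeneous sets\<close>

text \<open>Only the last triple of a tight path is recorded, since extension depends on nothing
  else; \<open>l\<close> counts its quadruples, so it has \<open>l + 3\<close> vertices.\<close>

inductive path_end :: "(nat \<Rightarrow> nat \<Rightarrow> nat \<Rightarrow> nat \<Rightarrow> bool) \<Rightarrow> nat \<Rightarrow> nat \<Rightarrow> nat \<Rightarrow> nat \<Rightarrow> bool" for R where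
  base: "1 \<le> a \<Longrightarrow> a < b \<Longrightarrow> b < c \<Longrightarrow> path_end R 0 a b c"
| step: "path_end R l a b c \<Longrightarrow> c < d \<Longrightarrow> R a b c d \<Longrightarrow> path_end R (Suc l) b c d"

lemma path_end_sequence:
  assumes "path_end R l a b c"
  shows "\<exists>y. strict_mono_on {..<l + 3} y \<and> 1 \<le> y 0 \<and> y l = a \<and> y (l + 1) = b \<and> y (l + 2) = c \<and>
    (\<forall>i<l. R (y i) (y (i + 1)) (y (i + 2)) (y (i + 3)))"
  using assms
proof induction
  case (base a b c)
  then show ?case
    by (intro exI[of _ "\<lambda>i. if i = 0 then a else if i = 1 then b else c"]) (auto simp: strict_mono_on_def)
next
  case (step l a b c d)
  then obtain y where y: "strict_mono_on {..<l + 3} y" "1 \<le> y 0" "y l = a" "y (l + 1) = b" "y (l + 2) = c"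
    "\<And>i. i < l \<Longrightarrow> R (y i) (y (i + 1)) (y (i + 2)) (y (i + 3))" by auto
  have below_d: "y i < d" if "i < l + 3" for i
  proof -
    have "y i \<le> y (l + 2)"
      using strict_mono_on_leD[OF y(1), of i "l + 2"] that by auto
    then show ?thesis using y(5) step by simp
  qed
  define z where "z = y(l + 3 := d)"
  have "strict_mono_on {..<Suc l + 3} z"
    using y(1) below_d by (auto simp: strict_mono_on_def z_def less_Suc_eq)
  moreover have "R (z i) (z (i + 1)) (z (i + 2)) (z (i + 3))" if "i < Suc l" for i
    using y that step by (cases "i = l") (auto simp: z_def)
  moreover have "1 \<le> z 0" "z (Suc l) = b" "z (Suc l + 1) = c" "z (Suc l + 2) = d"
    using y by (auto simp: z_def)
  ultimately show ?case by blast
qed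

text \<open>If no monochromatic path is long, each triple gets a pair of path lengths in \<open>{..<n} \<times> {..<n}\<close>
  that cannot weakly decrease along a 4-tuple. Taking up-sets twice turns this into an injection
  from vertices into sets of up-sets, which saves one exponential over the generic Ramsey bound.\<close>

lemma long_path_end_exists:
  assumes n: "0 < n" and N: "2 ^ (4 ^ n) < N"
  shows "\<exists>a b c. c \<le> N \<and> (path_end R n a b c \<or> path_end (\<lambda>a b c d. \<not> R a b c d) n a b c)"
proof (rule ccontr)
  assume none: "\<not> ?thesis"
  \<comment> \<open>The bound keeps the set finite, and \<open>0\<close> always belongs to it, so
    the maximum exists.\<close>
  define L where "L Q a b c = Max {l. l < n \<and> path_end Q l a b c}" for Q a b c
  have L: "L Q a b c < n" "path_end Q (L Q a b c) a b c" if "1 \<le> a" "a < b" "b < c" for Q a b c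
  proof -
    have "L Q a b c \<in> {l. l < n \<and> path_end Q l a b c}"
      unfolding L_def using n path_end.base[OF that] by (intro Max_in) auto
    then show "L Q a b c < n" "path_end Q (L Q a b c) a b c" by auto
  qed
  have L_step: "L Q a b c < L Q b c d"
    if "1 \<le> a" "a < b" "b < c" "c < d" "Q a b c d" "\<not> path_end Q n b c d" for Q a b c d
  proof -
    have e: "path_end Q (Suc (L Q a b c)) b c d"
      using L[of a b c Q] that by (intro path_end.step) auto
    then have "Suc (L Q a b c) \<noteq> n" using that by auto
    then have "Suc (L Q a b c) < n" using L(1)[of a b c Q] that by auto
    then have "Suc (L Q a b c) \<le> L Q b c d"
      unfolding L_def[of Q b c d] using e by (intro Max_ge) auto
    then show ?thesis by simp
  qed
  define R' where "R' = (\<lambda>a b c d. \<not> R a b c d)"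
  have no: "\<not> path_end R n a b c" "\<not> path_end R' n a b c" if "c \<le> N" for a b c
    using none that by (auto simp: R'_def)
  define V where "V b c = {(p, q). p < n \<and> q < n \<and>
     (\<exists>d. c < d \<and> d \<le> N \<and> L R b c d \<le> p \<and> L R' b c d \<le> q)}" for b c
  have V: "V b c \<in> upsets n" for b c
    by (fastforce simp: V_def upsets_def)
  \<comment> \<open>Extending \<open>a b c\<close> by \<open>d\<close> strictly raises one of the
    two labels, so no label of a triple \<open>b c d\<close> is weakly below that of
    \<open>a b c\<close>; this label separates \<open>V a b\<close> from
    \<open>V b c\<close>.\<close>
  have V_not_sub: "\<not> V a b \<subseteq> V b c" if abc: "1 \<le> a" "a < b" "b < c" "c \<le> N" for a b c
  proof
    assume "V a b \<subseteq> V b c"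
    moreover have "(L R a b c, L R' a b c) \<in> V a b"
      using abc L(1)[of a b c] by (auto simp: V_def)
    ultimately obtain d where d: "c < d" "d \<le> N" "L R b c d \<le> L R a b c" "L R' b c d \<le> L R' a b c"
      by (auto simp: V_def)
    show False
    proof (cases "R a b c d")
      case True
      then show ?thesis using L_step[of a b c d R] no[of d b c] abc d by auto
    next
      case False
      then show ?thesis using L_step[of a b c d R'] no[of d b c] abc d by (auto simp: R'_def)
    qed
  qed
  \<comment> \<open>Closing downwards under inclusion merges the sets \<open>V b c\<close> into one
    invariant of \<open>b\<close>. It lacks \<open>V a b\<close>, a member of \<open>W a\<close>,
    for every earlier vertex \<open>a\<close>.\<close>
  define W where "W b = {S \<in> upsets n. \<exists>c. b < c \<and> c \<le> N \<and> S \<subseteq> V b c}" for b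
  have W_ne: "W a \<noteq> W b" if "1 \<le> a" "a < b" "b \<le> N" for a b
  proof -
    have "V a b \<in> W a" using that V by (auto simp: W_def)
    moreover have "V a b \<notin> W b" using V_not_sub[of a b] that by (auto simp: W_def)
    ultimately show ?thesis by auto
  qed
  have "inj_on W {1..N}"
  proof (rule inj_onI)
    fix a b assume "a \<in> {1..N}" "b \<in> {1..N}" "W a = W b"
    then show "a = b" using W_ne[of a b] W_ne[of b a] by (cases a b rule: linorder_cases) auto
  qed
  moreover have "W ` {1..N} \<subseteq> Pow (upsets n)" by (auto simp: W_def)
  ultimately have "card {1..N} \<le> card (Pow (upsets n))"
    by (rule card_inj_on_le) (simp add: finite_upsets)
  also have "\<dots> \<le> 2 ^ (4 ^ n)" using card_upsets_le[of n] by (simp add: card_Pow finite_upsets)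
  finally show False using N by simp
qed

text \<open>Induction on the spread \<open>d - a\<close>. Where neighbours are not consecutive, a
  fifth point is inserted; the first four and the last four of the five points have smaller spread,
  and transitivity yields the required quadruple.\<close>

lemma transitive_path_imp_clique:
  fixes Q :: "nat \<Rightarrow> nat \<Rightarrow> nat \<Rightarrow> nat \<Rightarrow> bool"
  assumes trans: "\<And>a b c d e. a < b \<Longrightarrow> b < c \<Longrightarrow> c < d \<Longrightarrow> d < e \<Longrightarrow> e < m \<Longrightarrow>
      Q a b c d \<Longrightarrow> Q b c d e \<Longrightarrow> Q a b c e \<and> Q a b d e \<and> Q a c d e"
    and path: "\<And>i. i + 3 < m \<Longrightarrow> Q i (i + 1) (i + 2) (i + 3)"
  shows "a < b \<Longrightarrow> b < c \<Longrightarrow> c < d \<Longrightarrow> d < m \<Longrightarrow> Q a b c d"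
proof (induction "d - a" arbitrary: a b c d rule: less_induct)
  case less
  consider "a + 1 < b" | "b + 1 < c" | "c + 1 < d" | "b = a + 1 \<and> c = a + 2 \<and> d = a + 3"
    using less.prems by linarith
  then show ?case
  proof cases
    case 1
    then show ?thesis
      using trans[of a "a + 1" b c d] less.hyps[of c a "a + 1" b] less.hyps[of d "a + 1" b c] less.prems by auto
  next
    case 2
    then show ?thesis
      using trans[of a b "b + 1" c d] less.hyps[of c a b "b + 1"] less.hyps[of d b "b + 1" c] less.prems by auto
  next
    case 3
    then show ?thesis
      using trans[of a b c "c + 1" d] less.hyps[of "c + 1" a b c] less.hyps[of d b c "c + 1"] less.prems by auto
  next
    case 4
    then show ?thesis using path[of a] less.prems by simp
  qed
qed

section \<open>Separated scales\<close>

text \<open>The highest binary place where \<open>a\<close> and \<open>b\<close> differ, with value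
  \<open>0\<close> also for \<open>a = b\<close>. Phrased through quotients so that monotonicity of
  \<open>div\<close> applies.\<close>

definition top_diff :: "nat \<Rightarrow> nat \<Rightarrow> nat" where
  "top_diff a b = (LEAST q. a div 2 ^ Suc q = b div 2 ^ Suc q)"

lemma top_diff_commute: "top_diff a b = top_diff b a"
  by (simp add: top_diff_def eq_commute)

lemma top_diff_le_iff: "top_diff a b \<le> q \<longleftrightarrow> a div 2 ^ Suc q = b div 2 ^ Suc q"
proof
  assume le: "top_diff a b \<le> q"
  have "a div 2 ^ Suc (a + b) = b div 2 ^ Suc (a + b)"
    using less_exp[of "Suc (a + b)"] by simp
  then have eq: "a div 2 ^ Suc (top_diff a b) = b div 2 ^ Suc (top_diff a b)"
    unfolding top_diff_def by (rule LeastI)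
  have "(2::nat) ^ Suc q = 2 ^ Suc (top_diff a b) * 2 ^ (q - top_diff a b)"
    using le by (simp flip: power_add)
  then show "a div 2 ^ Suc q = b div 2 ^ Suc q" by (simp only: div_mult2_eq eq)
next
  assume "a div 2 ^ Suc q = b div 2 ^ Suc q"
  then show "top_diff a b \<le> q" unfolding top_diff_def by (rule Least_le)
qed

lemma top_diff_less:
  assumes "a < b" "b < 2 ^ m"
  shows "top_diff a b < m"
proof (cases m)
  case (Suc k)
  then have "top_diff a b \<le> k" using assms by (simp add: top_diff_le_iff)
  then show ?thesis using Suc by simp
qed (use assms in auto)

text \<open>An ultrametric equality: if the outer quotients agree, monotonicity forces the middle
  one to agree too.\<close>

lemma top_diff_max:
  assumes "a \<le> b" "b \<le> c"
  shows "top_diff a c = max (top_diff a b) (top_diff b c)"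
proof -
  have "top_diff a c \<le> q \<longleftrightarrow> max (top_diff a b) (top_diff b c) \<le> q" for q
    using div_le_mono[OF assms(1), of "2 ^ Suc q"] div_le_mono[OF assms(2), of "2 ^ Suc q"]
    unfolding max.bounded_iff top_diff_le_iff by auto
  then show ?thesis by (metis order_antisym order_refl)
qed

lemma top_diff_div_less:
  assumes "a < b"
  shows "a div 2 ^ top_diff a b < b div 2 ^ top_diff a b"
proof (cases "top_diff a b")
  case (Suc q)
  then have "\<not> top_diff a b \<le> q" by simp
  then have "a div 2 ^ Suc q \<noteq> b div 2 ^ Suc q" by (simp only: top_diff_le_iff not_False_eq_True)
  then show ?thesis using Suc div_le_mono[of a b "2 ^ Suc q"] assms by simp
qed (use assms in auto)

lemma top_diff_div_half:
  assumes "a < b"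
  shows "a div 2 ^ top_diff a b div 2 = b div 2 ^ top_diff a b div 2"
  using top_diff_le_iff[of a b "top_diff a b"] by (simp add: div_mult2_eq mult.commute[of 2])

text \<open>At a common top bit the three quotients would be distinct yet have the same half, and
  only two numbers do.\<close>

lemma top_diff_neq:
  assumes "a < b" "b < c"
  shows "top_diff a b \<noteq> top_diff b c"
proof
  assume eq: "top_diff a b = top_diff b c"
  show False
    using top_diff_div_less[OF assms(1)] top_diff_div_less[OF assms(2)]
      top_diff_div_half[OF assms(1)] top_diff_div_half[OF assms(2)] unfolding eq by linarith
qed

text \<open>Together with the shift invariance below, this describes \<open>top_diff\<close> on two
  consecutive blocks of length \<open>2 ^ h\<close>.\<close>

lemma top_diff_halves:
  assumes "a < 2 ^ h" "2 ^ h \<le> b" "b < 2 ^ Suc h"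
  shows "top_diff a b = h"
proof (rule antisym)
  show "top_diff a b \<le> h" using top_diff_less[of a b "Suc h"] assms by auto
  show "h \<le> top_diff a b"
  proof (rule ccontr)
    assume "\<not> h \<le> top_diff a b"
    then have "top_diff a b \<le> h - 1" "Suc (h - 1) = h" by auto
    then have "a div 2 ^ h = b div 2 ^ h" using top_diff_le_iff[of a b "h - 1"] by simp
    moreover have "b div 2 ^ h \<ge> 1" using div_le_mono[OF assms(2), of "2 ^ h"] by simp
    ultimately show False using assms(1) by simp
  qed
qed

lemma top_diff_shift:
  assumes "a < 2 ^ h" "b < 2 ^ h"
  shows "top_diff (2 ^ h + a) (2 ^ h + b) = top_diff a b"
proof -
  have "top_diff (2 ^ h + a) (2 ^ h + b) \<le> q \<longleftrightarrow> top_diff a b \<le> q" for q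
  proof (cases "Suc q \<le> h")
    case True
    have eq: "(2::nat) ^ h = 2 ^ Suc q * 2 ^ (h - Suc q)"
      using True by (simp only: flip: power_add) simp
    show ?thesis unfolding top_diff_le_iff eq by (simp del: power_Suc)
  next
    case False
    then have "(2::nat) ^ Suc h \<le> 2 ^ Suc q" by (intro power_increasing) auto
    then have "2 ^ h + a < 2 ^ Suc q" "2 ^ h + b < 2 ^ Suc q" "a < 2 ^ Suc q" "b < 2 ^ Suc q"
      using assms unfolding power_Suc[of 2 h] by linarith+
    then show ?thesis unfolding top_diff_le_iff by (simp del: power_Suc)
  qed
  then show ?thesis by (metis order_antisym order_refl)
qed

section \<open>Widths and slopes on separated scales\<close>

text \<open>Bounds the deviation of \<open>z b - z a\<close> from \<open>u q * (t b - t a)\<close>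
  for lifted points with top differing bit \<open>q\<close>: each lower bit \<open>l\<close>
  contributes at most \<open>w l * (u l - u q)\<close>.\<close>

definition scale_error :: "(nat \<Rightarrow> real) \<Rightarrow> (nat \<Rightarrow> real) \<Rightarrow> nat \<Rightarrow> real" where
  "scale_error w u q = (\<Sum>l<q. w l * (u l - u q))"

text \<open>For neighbours differing at top bits \<open>q < r\<close>, the second divided difference
  is close to \<open>- (u q - u r) / w r\<close>, as the outer distance has scale
  \<open>w r\<close>. The last two clauses order these values along \<open>q < r < s\<close> by the
  bits of the positions. The factors \<open>20\<close> and \<open>4\<close> leave room for the lower
  bits.\<close>

definition separated_scales :: "nat \<Rightarrow> (nat \<Rightarrow> real) \<Rightarrow> (nat \<Rightarrow> real) \<Rightarrow> bool" where
  "separated_scales m w u \<longleftrightarrow>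
    (\<forall>q<m. 0 < w q) \<and>
    (\<forall>q r. q < r \<longrightarrow> r < m \<longrightarrow> u r < u q) \<and>
    (\<forall>q<m. \<forall>r<m. r \<noteq> q \<longrightarrow> 20 * scale_error w u q < w q * \<bar>u q - u r\<bar>) \<and>
    (\<forall>q r s. q < r \<longrightarrow> r < s \<longrightarrow> s < m \<longrightarrow> top_diff r s < top_diff q r \<longrightarrow>
       4 * ((u r - u s) / w s) \<le> (u q - u r) / w r) \<and>
    (\<forall>q r s. q < r \<longrightarrow> r < s \<longrightarrow> s < m \<longrightarrow> top_diff q r < top_diff r s \<longrightarrow>
       4 * ((u q - u r) / w r) \<le> (u r - u s) / w s)"

lemma separated_scalesD:
  assumes "separated_scales m w u"
  shows "\<And>q. q < m \<Longrightarrow> 0 < w q"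
    and "\<And>q r. q < r \<Longrightarrow> r < m \<Longrightarrow> u r < u q"
    and "\<And>q r. q < m \<Longrightarrow> r < m \<Longrightarrow> r \<noteq> q \<Longrightarrow> 20 * scale_error w u q < w q * \<bar>u q - u r\<bar>"
    and "\<And>q r s. q < r \<Longrightarrow> r < s \<Longrightarrow> s < m \<Longrightarrow> top_diff r s < top_diff q r \<Longrightarrow>
       4 * ((u r - u s) / w s) \<le> (u q - u r) / w r"
    and "\<And>q r s. q < r \<Longrightarrow> r < s \<Longrightarrow> s < m \<Longrightarrow> top_diff q r < top_diff r s \<Longrightarrow>
       4 * ((u q - u r) / w r) \<le> (u r - u s) / w s"
  by (use assms[unfolded separated_scales_def, THEN conjunct1] in simp)
    (use assms[unfolded separated_scales_def, THEN conjunct2, THEN conjunct1] in simp,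
     use assms[unfolded separated_scales_def, THEN conjunct2, THEN conjunct2, THEN conjunct1] in simp,
     use assms[unfolded separated_scales_def, THEN conjunct2, THEN conjunct2, THEN conjunct2, THEN conjunct1] in simp,
     use assms[unfolded separated_scales_def, THEN conjunct2, THEN conjunct2, THEN conjunct2, THEN conjunct2] in simp)

text \<open>In the error clause for \<open>r = q - 1\<close>, every summand contains at least the
  gap \<open>u (q - 1) - u q\<close>, which cancels.\<close>

lemma separated_scales_sum:
  assumes S: "separated_scales m w u" and q: "q < m"
  shows "20 * (\<Sum>l<q. w l) \<le> w q"
proof (cases q)
  case 0
  then show ?thesis using separated_scalesD(1)[OF S q] by simp
next
  case (Suc p)
  define g where "g = u p - u q"
  have g: "g > 0" using separated_scalesD(2)[OF S, of p q] Suc q by (simp add: g_def)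
  have "20 * ((\<Sum>l<q. w l) * g) \<le> 20 * scale_error w u q"
    unfolding scale_error_def sum_distrib_right
  proof (intro mult_left_mono sum_mono)
    fix l assume l: "l \<in> {..<q}"
    then have "u p \<le> u l" using separated_scalesD(2)[OF S, of l p] Suc q by (cases "l = p") auto
    then show "g \<le> u l - u q" by (simp add: g_def)
    show "0 \<le> w l" using separated_scalesD(1)[OF S, of l] l q by simp
  qed simp
  also have "\<dots> \<le> w q * g"
    using separated_scalesD(3)[OF S q, of p] g Suc q by (simp add: g_def abs_minus_commute)
  finally have "(20 * (\<Sum>l<q. w l)) * g \<le> w q * g" by simp
  then show ?thesis using g by (rule mult_right_le_imp_le)
qed

lemma separated_scales_mono:
  assumes S: "separated_scales m w u" and "q < r" "r < m"
  shows "w q \<le> w r"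
proof -
  have "w q \<le> (\<Sum>l<r. w l)"
    using separated_scalesD(1)[OF S] assms by (intro member_le_sum) (auto intro: less_imp_le)
  moreover have "0 \<le> w q" using separated_scalesD(1)[OF S, of q] assms by simp
  ultimately show ?thesis using separated_scales_sum[OF S, of r] assms by linarith
qed

lemma eventually_mult_less_at_right_0:
  fixes c d :: real
  assumes "0 < d"
  shows "eventually (\<lambda>x. x * c < d) (at_right 0)"
proof -
  have "((\<lambda>x. x * c) \<longlongrightarrow> 0 * c) (at_right 0)" by (intro tendsto_intros)
  then show ?thesis using assms by (intro order_tendstoD(2)) auto
qed

lemma eventually_affine_less_at_top:
  fixes a b d :: real
  assumes "b < d"
  shows "eventually (\<lambda>x. a + x * b < x * d) at_top"
  using eventually_gt_at_top[of "a / (d - b)"]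
proof eventually_elim
  case (elim x)
  then have "a < x * (d - b)" using assms by (simp add: divide_less_eq)
  then show ?case by (simp add: algebra_simps)
qed

text \<open>Two copies of the scales: the lower block has its slopes compressed by \<open>F\<close>
  and raised by \<open>K\<close>, the upper block its widths multiplied by \<open>W\<close>. The
  choices come in the order \<open>K\<close> (large), \<open>W\<close> (large), \<open>F\<close>
  (small).\<close>

lemma separated_scales_double:
  assumes S: "separated_scales (2 ^ h) w u"
  obtains w' u' where "separated_scales (2 ^ Suc h) w' u'"
proof -
  define n :: nat where "n = 2 ^ h"
  have n: "n > 0" "2 ^ Suc h = n + n" by (auto simp: n_def)
  note S = S[folded n_def]
  note D = separated_scalesD[OF S]
  have u_le: "u r \<le> u q" if "q \<le> r" "r < n" for q r using D(2)[of q r] that by (cases "q = r") auto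
  define v where "v q = u q - u (n - 1)" for q
  have v: "0 \<le> v q" "u q \<le> u 0" "v q \<le> v 0" if "q < n" for q
    using u_le[of q "n - 1"] u_le[of 0 q] that by (auto simp: v_def)
  \<comment> \<open>Puts every lower slope above every upper one by at least
    \<open>1 + 4 * v 0\<close>, where \<open>v 0\<close> is the whole range of
    \<open>u\<close>.\<close>
  define K where "K = u 0 + 1 + 4 * v 0"
  \<comment> \<open>Bounds the error that the lower block adds at upper position \<open>q\<close>,
    uniformly in \<open>F < 1\<close>, so that \<open>W\<close> can be chosen before
    \<open>F\<close>.\<close>
  define A where "A q = (\<Sum>l<n. w l * (K + v l - u q))" for q
  have E: "20 * scale_error w u q < w q * d"
    if "q < n" "d = 1 \<and> q = 0 \<or> (\<exists>r<n. r \<noteq> q \<and> d = \<bar>u q - u r\<bar>)" for q d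
    using that D(1,3)[of q] by (auto simp: scale_error_def)
  \<comment> \<open>The gaps that the error at \<open>q\<close> must stay below. Position
    \<open>0\<close> has zero error in the old scales; the value \<open>1\<close> serves its
    comparison with the lower block, also for \<open>n = 1\<close>, when no other gap
    exists.\<close>
  define Ds where "Ds q = (if q = 0 then {1} else {}) \<union> (\<lambda>r. \<bar>u q - u r\<bar>) ` {r. r < n \<and> r \<noteq> q}" for q
  have "eventually (\<lambda>W. \<forall>q\<in>{..<n}. \<forall>d\<in>Ds q. 20 * A q + W * (20 * scale_error w u q) < W * (w q * d)) at_top"
    by (intro eventually_ball_finite ballI eventually_affine_less_at_top E)
      (auto simp: Ds_def split: if_splits)
  then have "eventually (\<lambda>W. W > 0 \<and> (\<forall>q\<in>{..<n}. \<forall>d\<in>Ds q. 20 * A q + W * (20 * scale_error w u q) < W * (w q * d))) at_top"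
    using eventually_gt_at_top[of "0::real"] by eventually_elim auto
  then obtain W where W0: "W > 0"
    and W: "\<And>q d. q < n \<Longrightarrow> d \<in> Ds q \<Longrightarrow> 20 * A q + W * (20 * scale_error w u q) < W * (w q * d)"
    by (auto dest!: eventually_happens)
  \<comment> \<open>\<open>F\<close> comes after \<open>W\<close>, because scaled lower differences
    must fall below every \<open>1 / (W * w s)\<close>.\<close>
  have "eventually (\<lambda>F. \<forall>q\<in>{..<n}. F * (20 * scale_error w u q) < w q) (at_right 0)"
    by (intro eventually_ball_finite ballI eventually_mult_less_at_right_0 D(1)) auto
  moreover have "eventually (\<lambda>F. \<forall>q\<in>{..<n}. \<forall>r\<in>{..<n}. \<forall>s\<in>{..<n}.
       F * (4 * ((u q - u r) / w r)) < 1 / (W * w s)) (at_right 0)"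
    using W0 by (intro eventually_ball_finite ballI eventually_mult_less_at_right_0) (auto intro!: D(1) divide_pos_pos mult_pos_pos)
  moreover have "eventually (\<lambda>F. F < 1) (at_right (0::real))"
    using eventually_mult_less_at_right_0[of 1 1] by simp
  moreover have "eventually (\<lambda>F. F > 0) (at_right (0::real))" by (simp add: eventually_at_right_less)
  ultimately have "eventually (\<lambda>F. 0 < F \<and> F < 1 \<and> (\<forall>q\<in>{..<n}. F * (20 * scale_error w u q) < w q) \<and>
       (\<forall>q\<in>{..<n}. \<forall>r\<in>{..<n}. \<forall>s\<in>{..<n}. F * (4 * ((u q - u r) / w r)) < 1 / (W * w s))) (at_right 0)"
    by eventually_elim auto
  then obtain F where F: "0 < F" "F < 1" "\<And>q. q < n \<Longrightarrow> F * (20 * scale_error w u q) < w q"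
      "\<And>q r s. q < n \<Longrightarrow> r < n \<Longrightarrow> s < n \<Longrightarrow> F * (4 * ((u q - u r) / w r)) < 1 / (W * w s)"
    by (auto dest!: eventually_happens)
  define w' where "w' q = (if q < n then w q else W * w (q - n))" for q
  define u' where "u' q = (if q < n then K + F * v q else u (q - n))" for q
  have lo [simp]: "w' q = w q" "u' q = K + F * v q" if "q < n" for q
    using that by (auto simp: w'_def u'_def)
  have hi [simp]: "w' (n + q) = W * w q" "u' (n + q) = u q" for q
    by (auto simp: w'_def u'_def)
  have Fv: "0 \<le> F * v q" "F * v q \<le> v q" if "q < n" for q
    using F v(1)[OF that] mult_right_mono[of F 1 "v q"] by auto
  have v_diff: "F * v q - F * v r = F * (u q - u r)" for q r by (simp add: v_def algebra_simps)
  have scale_F: "F * (4 * (x / y)) = 4 * (F * x / y)" "F * (x / y) = F * x / y" for x y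
    by simp_all
  have gap: "1 + 4 * v 0 \<le> u' q - u r" if "q < n" "r < n" for q r
    using that Fv[of q] v[of r] by (simp add: K_def)
  have gap1: "1 \<le> u' q - u r" if "q < n" "r < n" for q r
    using gap[OF that] v(1)[of 0] n by simp
  have cases2: "q < n \<or> (\<exists>p<n. q = n + p)" if "q < n + n" for q
    using that by (cases "q < n") (auto intro!: exI[of _ "q - n"])
  have "separated_scales (n + n) w' u'"
    unfolding separated_scales_def
  proof (intro conjI allI impI)
    fix q assume "q < n + n"
    then show "0 < w' q" using cases2[of q] D(1) W0 by auto
  next
    fix q r assume qr: "q < r" "r < n + n"
    then consider "q < n" "r < n" | r' where "q < n" "r = n + r'" "r' < n"
      | q' r' where "q = n + q'" "r = n + r'" "q' < n" "r' < n"
      using cases2[of q] cases2[of r] by force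
    then show "u' r < u' q"
    proof cases
      case 1
      then show ?thesis using D(2)[of q r] F qr by (simp add: v_def)
    next
      case 2
      then show ?thesis using gap1[of q r'] by simp
    next
      case 3
      then show ?thesis using D(2)[of q' r'] qr by simp
    qed
  next
    fix q r assume qr: "q < n + n" "r < n + n" "r \<noteq> q"
    show "20 * scale_error w' u' q < w' q * \<bar>u' q - u' r\<bar>"
    proof (cases "q < n")
      case True
      have e: "scale_error w' u' q = F * scale_error w u q"
        unfolding scale_error_def sum_distrib_left
        using True by (intro sum.cong) (auto simp: v_def algebra_simps)
      show ?thesis
      proof (cases "r < n")
        case r: True
        have "\<bar>u' q - u' r\<bar> = F * \<bar>u q - u r\<bar>"
          using True r F v_diff[of q r] by (simp add: abs_mult)
        then show ?thesis unfolding e using D(3)[of q r] True r qr F by simp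
      next
        case False
        then obtain r' where r': "r = n + r'" "r' < n" using cases2 qr by auto
        have "20 * (F * scale_error w u q) < w q" using F(3)[OF True] by (simp add: mult_ac)
        also have "\<dots> \<le> w q * \<bar>u' q - u' r\<bar>"
          using mult_left_mono[of 1 "\<bar>u' q - u r'\<bar>" "w q"] D(1)[OF True] gap1[OF True r'(2)]
          by (simp add: r' del: lo)
        finally show ?thesis unfolding e using True by simp
      qed
    next
      case False
      then obtain q' where q': "q = n + q'" "q' < n" using cases2 qr by auto
      have split: "{..<n + q'} = {..<n} \<union> (\<lambda>l. n + l) ` {..<q'}"
      proof (rule set_eqI)
        fix x
        show "x \<in> {..<n + q'} \<longleftrightarrow> x \<in> {..<n} \<union> (\<lambda>l. n + l) ` {..<q'}"
          by (cases "x < n") (auto simp: image_iff intro!: bexI[of _ "x - n"])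
      qed
      have "scale_error w' u' q = (\<Sum>l<n. w' l * (u' l - u q')) + (\<Sum>l\<in>(\<lambda>l. n + l) ` {..<q'}. w' l * (u' l - u q'))"
        unfolding scale_error_def q' hi(2) split by (intro sum.union_disjoint) auto
      also have "(\<Sum>l\<in>(\<lambda>l. n + l) ` {..<q'}. w' l * (u' l - u q')) = W * scale_error w u q'"
        by (subst sum.reindex) (auto simp: scale_error_def sum_distrib_left mult.assoc)
      also have "(\<Sum>l<n. w' l * (u' l - u q')) \<le> A q'"
        unfolding A_def using Fv(2) D(1) by (intro sum_mono) (auto intro!: mult_left_mono less_imp_le)
      finally have err: "scale_error w' u' q \<le> A q' + W * scale_error w u q'" by simp
      have bound: "20 * scale_error w' u' q < W * w q' * d" if "d \<in> Ds q'" for d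
        using err W[OF q'(2) that] by (simp add: mult.assoc)
      show ?thesis
      proof (cases "r < n")
        case False
        then obtain r' where r': "r = n + r'" "r' < n" using cases2 qr by auto
        then show ?thesis using bound[of "\<bar>u q' - u r'\<bar>"] qr q' by (auto simp: Ds_def)
      next
        case r: True
        \<comment> \<open>A gap already tested within the upper block, or \<open>1\<close>; it is at
          most the distance to any lower slope.\<close>
        define d where "d = (if q' = 0 then 1 else \<bar>u q' - u (q' - 1)\<bar>)"
        have "d \<in> Ds q'" using q' by (auto simp: d_def Ds_def)
        moreover have "q' - 1 < n" using q'(2) by simp
        then have "d \<le> \<bar>u' q - u' r\<bar>"
          using gap[OF r q'(2)] v[of q'] u_le[of 0 "q' - 1"] u_le[of "q' - 1" q'] v(1)[of 0] q'(2) n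
          unfolding d_def v_def q'(1) hi by (auto simp: abs_if)
        then have "W * w q' * d \<le> W * w q' * \<bar>u' q - u' r\<bar>"
          using D(1)[OF q'(2)] W0 by (intro mult_left_mono) auto
        ultimately have "20 * scale_error w' u' q < W * w q' * \<bar>u' q - u' r\<bar>"
          using bound[of d] by linarith
        then show ?thesis by (simp add: q')
      qed
    qed
  next
    fix q r s assume qrs: "q < r" "r < s" "s < n + n" "top_diff r s < top_diff q r"
    consider "s < n" | s' where "r < n" "s = n + s'" "s' < n"
      | r' s' where "q < n" "r = n + r'" "s = n + s'" "r' < n" "s' < n"
      | q' r' s' where "q = n + q'" "r = n + r'" "s = n + s'" "q' < n" "r' < n" "s' < n"
      using cases2[of q] cases2[of r] cases2[of s] qrs by force
    then show "4 * ((u' r - u' s) / w' s) \<le> (u' q - u' r) / w' r"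
    proof cases
      case 1
      then have "4 * ((u r - u s) / w s) \<le> (u q - u r) / w r" using D(4) qrs by simp
      from mult_left_mono[OF this less_imp_le[OF F(1)]] show ?thesis
        using 1 qrs unfolding scale_F by (simp del: right_diff_distrib_numeral add: v_diff)
    next
      \<comment> \<open>A pair straddling the blocks differs at bit \<open>h\<close>, above all
        differences inside a block, so the hypothesis fails.\<close>
      case 2
      then have "top_diff r s = h" "top_diff q r < h"
        using top_diff_halves[of r h s] top_diff_less[of q r h] qrs n by (auto simp: n_def)
      then show ?thesis using qrs by simp
    next
      \<comment> \<open>The raise by \<open>K\<close> makes the first gap at least four times any
        gap within the upper block, and widths only grow from \<open>r'\<close> to
        \<open>s'\<close>.\<close>
      case 3
      have rs: "r' < s'" using 3 qrs by simp
      have w: "0 < w r'" "w r' \<le> w s'" "0 < w s'"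
        using separated_scales_mono[OF S rs] D(1) 3 by auto
      have "4 * (u r' - u s') \<le> 4 * v 0" using v[of r'] v[of s'] 3 by (simp add: v_def)
      also have "\<dots> \<le> u' q - u r'" using gap[of q r'] 3 by simp
      finally have *: "4 * (u r' - u s') \<le> u' q - u r'" .
      have "4 * (u r' - u s') / (W * w s') \<le> (u' q - u r') / (W * w r')"
        using w W0 gap1[of q r'] 3 by (intro frac_le *) auto
      then show ?thesis using 3 by simp
    next
      case 4
      then have "top_diff r' s' < top_diff q' r'" using qrs by (simp add: n_def top_diff_shift)
      then have "4 * ((u r' - u s') / w s') \<le> (u q' - u r') / w r'" using D(4) 4 qrs by simp
      from divide_right_mono[OF this, of W] show ?thesis using W0 4 by (simp add: mult.commute)
    qed
  next
    fix q r s assume qrs: "q < r" "r < s" "s < n + n" "top_diff q r < top_diff r s"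
    consider "s < n" | s' where "r < n" "s = n + s'" "s' < n"
      | r' s' where "q < n" "r = n + r'" "s = n + s'" "r' < n" "s' < n"
      | q' r' s' where "q = n + q'" "r = n + r'" "s = n + s'" "q' < n" "r' < n" "s' < n"
      using cases2[of q] cases2[of r] cases2[of s] qrs by force
    then show "4 * ((u' q - u' r) / w' r) \<le> (u' r - u' s) / w' s"
    proof cases
      case 1
      then have "4 * ((u q - u r) / w r) \<le> (u r - u s) / w s" using D(5) qrs by simp
      from mult_left_mono[OF this less_imp_le[OF F(1)]] show ?thesis
        using 1 qrs unfolding scale_F by (simp del: right_diff_distrib_numeral add: v_diff)
    next
      \<comment> \<open>The straddling gap is at least \<open>1\<close>; the compression by
        \<open>F\<close> beats it even after division by \<open>W * w s'\<close>.\<close>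
      case 2
      have "F * (4 * ((u q - u r) / w r)) \<le> 1 / (W * w s')" using F(4)[of q r s'] 2 qrs by simp
      also have "\<dots> \<le> (u' r - u s') / (W * w s')"
        using gap1[of r s'] 2 W0 D(1)[of s'] by (intro divide_right_mono) auto
      finally show ?thesis
        using 2 qrs unfolding scale_F by (simp del: right_diff_distrib_numeral add: v_diff)
    next
      case 3
      then have "top_diff r s < h" "top_diff q r = h"
        using top_diff_halves[of q h r] top_diff_less[of r' s' h] top_diff_shift[of r' h s'] qrs n
        by (auto simp: n_def)
      then show ?thesis using qrs by simp
    next
      case 4
      then have "top_diff q' r' < top_diff r' s'" using qrs by (simp add: n_def top_diff_shift)
      then have "4 * ((u q' - u r') / w r') \<le> (u r' - u s') / w s'" using D(5) 4 qrs by simp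
      from divide_right_mono[OF this, of W] show ?thesis using W0 4 by (simp add: mult.commute)
    qed
  qed
  then show ?thesis using that n(2) by metis
qed

lemma separated_scales_exist: "\<exists>w u. separated_scales (2 ^ h) w u"
proof (induction h)
  case 0
  have "separated_scales (2 ^ 0) (\<lambda>_. 1) (\<lambda>_. 0)"
    unfolding separated_scales_def by auto
  then show ?case by blast
next
  case (Suc h)
  then show ?case using separated_scales_double by metis
qed

section \<open>The lifted binary strings\<close>

definition level_sum :: "nat \<Rightarrow> (nat \<Rightarrow> real) \<Rightarrow> nat \<Rightarrow> real" where
  "level_sum m w a = (\<Sum>l<m. w l * real (a div 2 ^ l mod 2))"

text \<open>Bits above \<open>q\<close> agree and cancel; at \<open>q\<close> itself the smaller
  number has bit \<open>0\<close> and the larger has bit \<open>1\<close>.\<close>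

lemma level_sum_diff:
  assumes ab: "a < b" "b < 2 ^ m"
  defines "q \<equiv> top_diff a b"
  shows "level_sum m w b - level_sum m w a =
    w q + (\<Sum>l<q. w l * (real (b div 2 ^ l mod 2) - real (a div 2 ^ l mod 2)))"
proof -
  have q: "q < m" using top_diff_less[OF ab] by (simp add: q_def)
  define f where "f l = w l * (real (b div 2 ^ l mod 2) - real (a div 2 ^ l mod 2))" for l
  have "level_sum m w b - level_sum m w a = sum f {..<m}"
    by (simp add: level_sum_def f_def sum_subtractf right_diff_distrib)
  also have "\<dots> = sum f {..<Suc q}"
  proof (rule sum.mono_neutral_right)
    show "\<forall>l\<in>{..<m} - {..<Suc q}. f l = 0"
    proof
      fix l assume "l \<in> {..<m} - {..<Suc q}"
      then have "top_diff a b \<le> l - 1" "Suc (l - 1) = l" by (auto simp: q_def)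
      then have "a div 2 ^ l = b div 2 ^ l" using top_diff_le_iff[of a b "l - 1"] by simp
      then show "f l = 0" by (simp add: f_def)
    qed
  qed (use q in auto)
  also have "\<dots> = f q + sum f {..<q}" by simp
  also have "f q = w q"
  proof -
    have half: "x mod 2 = 0 \<and> y mod 2 = 1" if "x < y" "x div 2 = y div 2" for x y :: nat
      using that by presburger
    have "a div 2 ^ q mod 2 = 0 \<and> b div 2 ^ q mod 2 = 1"
      using half[OF top_diff_div_less[OF ab(1)] top_diff_div_half[OF ab(1)]] by (simp add: q_def)
    then show ?thesis by (simp add: f_def)
  qed
  finally show ?thesis by (simp add: f_def)
qed

lemma bit_diff_abs:
  fixes a b l :: nat and c :: real
  assumes "0 \<le> c"
  shows "\<bar>c * (real (b div 2 ^ l mod 2) - real (a div 2 ^ l mod 2))\<bar> \<le> c"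
proof -
  have bit: "x mod 2 = 0 \<or> x mod 2 = 1" for x :: nat by presburger
  show ?thesis using assms bit[of "a div 2 ^ l"] bit[of "b div 2 ^ l"] by auto
qed

text \<open>The inaccuracies enlarge \<open>y / r\<close> by a factor of at most
  \<open>24/19\<close> and shrink \<open>x / p\<close> by no more than \<open>16/21\<close>; the
  spare factor \<open>4\<close> covers both.\<close>

lemma quotient_compare:
  fixes x y p r X Y P R :: real
  assumes "0 < x" "0 < y" "0 < p" "0 < r"
    and X: "4/5 * x \<le> X" and Y: "Y \<le> 6/5 * y" and P: "P \<le> 21/20 * p" "19/20 * p \<le> P" and R: "19/20 * r \<le> R"
    and le: "4 * (y / r) \<le> x / p"
  shows "Y / R < X / P"
proof -
  have "Y / R \<le> (6/5 * y) / (19/20 * r)"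
    using assms by (intro frac_le) auto
  also have "\<dots> = 24/19 * (y / r)" by simp
  also have "\<dots> \<le> 6/19 * (x / p)" using le by simp
  also have "\<dots> < 16/21 * (x / p)" using assms by (intro mult_strict_right_mono) auto
  also have "\<dots> = (4/5 * x) / (21/20 * p)" by simp
  also have "\<dots> \<le> X / P" using assms by (intro frac_le) auto
  finally show ?thesis .
qed

context
  fixes m :: nat and w u :: "nat \<Rightarrow> real" and t z :: "nat \<Rightarrow> real"
  assumes S: "separated_scales m w u"
  defines "t \<equiv> level_sum m w" and "z \<equiv> level_sum m (\<lambda>l. w l * u l)"
begin

text \<open>Lower bits change the distance by at most the sum of their widths, a twentieth of the
  top width at most.\<close>

lemma level_distance:
  assumes "a < b" "b < 2 ^ m"
  shows "\<bar>t b - t a - w (top_diff a b)\<bar> \<le> w (top_diff a b) / 20"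
proof -
  define q where "q = top_diff a b"
  have q: "q < m" using top_diff_less[OF assms] by (simp add: q_def)
  have "\<bar>t b - t a - w q\<bar> = \<bar>\<Sum>l<q. w l * (real (b div 2 ^ l mod 2) - real (a div 2 ^ l mod 2))\<bar>"
    using level_sum_diff[OF assms, of w] by (simp add: t_def q_def)
  also have "\<dots> \<le> (\<Sum>l<q. \<bar>w l * (real (b div 2 ^ l mod 2) - real (a div 2 ^ l mod 2))\<bar>)"
    by (rule sum_abs)
  also have "\<dots> \<le> (\<Sum>l<q. w l)"
  proof (rule sum_mono)
    fix l assume "l \<in> {..<q}"
    then have "0 \<le> w l" using separated_scalesD(1)[OF S, of l] q by simp
    then show "\<bar>w l * (real (b div 2 ^ l mod 2) - real (a div 2 ^ l mod 2))\<bar> \<le> w l"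
      by (rule bit_diff_abs)
  qed
  also have "\<dots> \<le> w q / 20" using separated_scales_sum[OF S q] by simp
  finally show ?thesis by (simp add: q_def)
qed

lemma level_distance_bounds:
  assumes "a < b" "b < 2 ^ m" "top_diff a b = q"
  shows "19/20 * w q \<le> t b - t a" "t b - t a \<le> 21/20 * w q" "t a < t b"
proof -
  have "0 < w q" using separated_scalesD(1)[OF S] top_diff_less[OF assms(1,2)] assms(3) by simp
  then show "19/20 * w q \<le> t b - t a" "t b - t a \<le> 21/20 * w q" "t a < t b"
    using level_distance[OF assms(1,2)] unfolding assms(3) abs_le_iff by linarith+
qed

text \<open>Bit \<open>q\<close> alone would give slope exactly \<open>u q\<close>. The lower bits
  contribute at most \<open>scale_error w u q\<close>, over a distance of at least
  \<open>w q / 2\<close>, which is a tenth of the gap to any other slope.\<close>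

lemma level_slope:
  assumes "a < b" "b < 2 ^ m" "top_diff a b = q" "r < m" "r \<noteq> q"
  shows "\<bar>(z b - z a) / (t b - t a) - u q\<bar> \<le> \<bar>u q - u r\<bar> / 10"
proof -
  have q: "q < m" using top_diff_less assms by blast
  define \<beta> where "\<beta> l = real (b div 2 ^ l mod 2) - real (a div 2 ^ l mod 2)" for l
  have zt: "z b - z a - u q * (t b - t a) = (\<Sum>l<q. w l * (u l - u q) * \<beta> l)"
    unfolding z_def t_def level_sum_diff[OF assms(1,2)] assms(3)
    by (simp add: distrib_left sum_distrib_left \<beta>_def left_diff_distrib right_diff_distrib sum_subtractf mult_ac)
  have "\<bar>z b - z a - u q * (t b - t a)\<bar> \<le> (\<Sum>l<q. \<bar>w l * (u l - u q) * \<beta> l\<bar>)"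
    unfolding zt by (rule sum_abs)
  also have "\<dots> \<le> scale_error w u q"
    unfolding scale_error_def
  proof (rule sum_mono)
    fix l assume "l \<in> {..<q}"
    then have "0 \<le> w l * (u l - u q)"
      using separated_scalesD(1)[OF S, of l] separated_scalesD(2)[OF S, of l q] q by simp
    then show "\<bar>w l * (u l - u q) * \<beta> l\<bar> \<le> w l * (u l - u q)"
      unfolding \<beta>_def by (rule bit_diff_abs)
  qed
  also have "\<dots> \<le> w q * \<bar>u q - u r\<bar> / 20" using separated_scalesD(3)[OF S q assms(4,5)] by simp
  also have "\<dots> \<le> (t b - t a) * (\<bar>u q - u r\<bar> / 10)"
  proof -
    have "w q / 2 \<le> t b - t a"
      using level_distance_bounds[OF assms(1-3)] separated_scalesD(1)[OF S q] by linarith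
    from mult_right_mono[OF this, of "\<bar>u q - u r\<bar> / 10"] show ?thesis by simp
  qed
  finally have *: "\<bar>z b - z a - u q * (t b - t a)\<bar> \<le> (t b - t a) * (\<bar>u q - u r\<bar> / 10)" .
  have pos: "0 < t b - t a" using level_distance_bounds[OF assms(1-3)] by simp
  have "(z b - z a) / (t b - t a) - u q = (z b - z a - u q * (t b - t a)) / (t b - t a)"
    using pos by (simp add: diff_divide_distrib)
  then have "\<bar>(z b - z a) / (t b - t a) - u q\<bar> = \<bar>z b - z a - u q * (t b - t a)\<bar> / (t b - t a)"
    using pos by (simp add: abs_divide)
  also have "\<dots> \<le> \<bar>u q - u r\<bar> / 10"
    using * pos by (simp add: divide_le_eq mult.commute)
  finally show ?thesis .
qed

text \<open>Two slopes, each off by at most a tenth of the gap, have a difference within a fifth of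
  it; the sign comes from \<open>u\<close> being decreasing.\<close>

lemma slope_diff:
  assumes "a < b" "b < c" "c < 2 ^ m" and q: "top_diff a b = q" "top_diff b c = r"
  defines "d \<equiv> (z c - z b) / (t c - t b) - (z b - z a) / (t b - t a)"
  shows "q < r \<Longrightarrow> 4/5 * (u q - u r) \<le> - d \<and> - d \<le> 6/5 * (u q - u r) \<and> 0 < u q - u r"
    and "r < q \<Longrightarrow> 4/5 * (u r - u q) \<le> d \<and> d \<le> 6/5 * (u r - u q) \<and> 0 < u r - u q"
proof -
  have qr: "q < m" "r < m" "q \<noteq> r"
    using top_diff_less[of a b m] top_diff_less[of b c m] top_diff_neq[of a b c] assms by auto
  have s: "\<bar>(z b - z a) / (t b - t a) - u q\<bar> \<le> \<bar>u q - u r\<bar> / 10"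
    "\<bar>(z c - z b) / (t c - t b) - u r\<bar> \<le> \<bar>u r - u q\<bar> / 10"
    using level_slope[of a b q r] level_slope[of b c r q] assms qr by auto
  define p p' where "p = (z b - z a) / (t b - t a)" and "p' = (z c - z b) / (t c - t b)"
  note s = s[folded p_def p'_def]
  have d: "d = p' - p" by (simp add: d_def p_def p'_def)
  show "4/5 * (u q - u r) \<le> - d \<and> - d \<le> 6/5 * (u q - u r) \<and> 0 < u q - u r" if "q < r"
    using s separated_scalesD(2)[OF S that qr(2)] unfolding d abs_le_iff by (simp add: abs_if)
  show "4/5 * (u r - u q) \<le> d \<and> d \<le> 6/5 * (u r - u q) \<and> 0 < u r - u q" if "r < q"
    using s separated_scalesD(2)[OF S that qr(1)] unfolding d abs_le_iff by (simp add: abs_if)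
qed

text \<open>At a local extremum of the top bits the two second differences have opposite signs. On
  monotone triples the signs agree, and the last two clauses of \<open>separated_scales\<close>
  compare the sizes; falling triples are read backwards.\<close>

lemma third_diff_cases:
  assumes abcd: "a < b" "b < c" "c < d" "d < 2 ^ m"
    and q: "top_diff a b = q" "top_diff b c = r" "top_diff c d = s"
  shows "q < r \<Longrightarrow> s < r \<Longrightarrow> 0 < third_diff t z a b c d"
    and "r < q \<Longrightarrow> r < s \<Longrightarrow> third_diff t z a b c d < 0"
    and "q < r \<Longrightarrow> r < s \<Longrightarrow> top_diff r s < top_diff q r \<Longrightarrow> 0 < third_diff t z a b c d"
    and "q < r \<Longrightarrow> r < s \<Longrightarrow> top_diff q r < top_diff r s \<Longrightarrow> third_diff t z a b c d < 0"
    and "r < q \<Longrightarrow> s < r \<Longrightarrow> top_diff q r < top_diff r s \<Longrightarrow> 0 < third_diff t z a b c d"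
    and "r < q \<Longrightarrow> s < r \<Longrightarrow> top_diff r s < top_diff q r \<Longrightarrow> third_diff t z a b c d < 0"
proof -
  define d1 d2 where "d1 = (z c - z b) / (t c - t b) - (z b - z a) / (t b - t a)"
    and "d2 = (z d - z c) / (t d - t c) - (z c - z b) / (t c - t b)"
  have D: "third_diff t z a b c d = d2 / (t d - t b) - d1 / (t c - t a)"
    by (simp add: third_diff_def Let_def d1_def d2_def)
  note d1 = slope_diff[of a b c q r, folded d1_def] and d2 = slope_diff[of b c d r s, folded d2_def]
  have less: "b < 2 ^ m" "c < 2 ^ m" "a < c" "b < d" using abcd by auto
  have m: "q < m" "r < m" "s < m" using top_diff_less q abcd less by blast+
  have w: "0 < w q" "0 < w r" "0 < w s" using separated_scalesD(1)[OF S] m by auto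
  have ac: "top_diff a c = max q r" and bd: "top_diff b d = max r s"
    using top_diff_max[of a b c] top_diff_max[of b c d] abcd q by auto
  note tac = level_distance_bounds[OF less(3,2) ac] and tbd = level_distance_bounds[OF less(4) abcd(4) bd]
  have pos: "0 < t c - t a" "0 < t d - t b" using tac tbd by auto
  note rules = separated_scalesD(4,5)[OF S]
  {
    assume "q < r" "s < r"
    then have "d1 < 0" "0 < d2" using d1 d2 abcd less q by fastforce+
    then have "d1 / (t c - t a) < 0" "0 < d2 / (t d - t b)" using pos by (auto simp: divide_neg_pos)
    then show "0 < third_diff t z a b c d" by (simp add: D)
  next
    assume "r < q" "r < s"
    then have "0 < d1" "d2 < 0" using d1 d2 abcd less q by fastforce+
    then have "0 < d1 / (t c - t a)" "d2 / (t d - t b) < 0" using pos by (auto simp: divide_neg_pos)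
    then show "third_diff t z a b c d < 0" by (simp add: D)
  next
    assume o: "q < r" "r < s" "top_diff r s < top_diff q r"
    have e1: "4/5 * (u q - u r) \<le> - d1" "- d1 \<le> 6/5 * (u q - u r)" "0 < u q - u r"
      using d1(1) abcd less q o by auto
    have e2: "4/5 * (u r - u s) \<le> - d2" "- d2 \<le> 6/5 * (u r - u s)" "0 < u r - u s"
      using d2(1) abcd less q o by auto
    have "(- d2) / (t d - t b) < (- d1) / (t c - t a)"
      by (rule quotient_compare[OF e1(3) e2(3) w(2,3) e1(1) e2(2)]) (use tac tbd rules(1)[OF o(1,2) m(3) o(3)] o in auto)
    then show "0 < third_diff t z a b c d" by (simp add: D)
  next
    assume o: "q < r" "r < s" "top_diff q r < top_diff r s"
    have e1: "4/5 * (u q - u r) \<le> - d1" "- d1 \<le> 6/5 * (u q - u r)" "0 < u q - u r"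
      using d1(1) abcd less q o by auto
    have e2: "4/5 * (u r - u s) \<le> - d2" "- d2 \<le> 6/5 * (u r - u s)" "0 < u r - u s"
      using d2(1) abcd less q o by auto
    have "(- d1) / (t c - t a) < (- d2) / (t d - t b)"
      by (rule quotient_compare[OF e2(3) e1(3) w(3,2) e2(1) e1(2)]) (use tac tbd rules(2)[OF o(1,2) m(3) o(3)] o in auto)
    then show "third_diff t z a b c d < 0" by (simp add: D)
  next
    assume o: "r < q" "s < r" "top_diff q r < top_diff r s"
    have e1: "4/5 * (u r - u q) \<le> d1" "d1 \<le> 6/5 * (u r - u q)" "0 < u r - u q"
      using d1(2) abcd less q o by auto
    have e2: "4/5 * (u s - u r) \<le> d2" "d2 \<le> 6/5 * (u s - u r)" "0 < u s - u r"
      using d2(2) abcd less q o by auto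
    have "d1 / (t c - t a) < d2 / (t d - t b)"
      by (rule quotient_compare[OF e2(3) e1(3) w(2,1) e2(1) e1(2)])
        (use tac tbd rules(1)[OF o(2,1) m(1)] o in \<open>auto simp: top_diff_commute\<close>)
    then show "0 < third_diff t z a b c d" by (simp add: D)
  next
    assume o: "r < q" "s < r" "top_diff r s < top_diff q r"
    have e1: "4/5 * (u r - u q) \<le> d1" "d1 \<le> 6/5 * (u r - u q)" "0 < u r - u q"
      using d1(2) abcd less q o by auto
    have e2: "4/5 * (u s - u r) \<le> d2" "d2 \<le> 6/5 * (u s - u r)" "0 < u s - u r"
      using d2(2) abcd less q o by auto
    have "d2 / (t d - t b) < d1 / (t c - t a)"
      by (rule quotient_compare[OF e1(3) e2(3) w(1,2) e1(1) e2(2)])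
        (use tac tbd rules(2)[OF o(2,1) m(1)] o in \<open>auto simp: top_diff_commute\<close>)
    then show "third_diff t z a b c d < 0" by (simp add: D)
  }
qed

text \<open>On a monotone triple of top bits, \<open>top_diff_neq\<close> applies once more, to the
  bit positions themselves.\<close>

lemma third_diff_nonzero:
  assumes abcd: "a < b" "b < c" "c < d" "d < 2 ^ m"
  shows "third_diff t z a b c d \<noteq> 0"
proof -
  define q r s where "q = top_diff a b" and "r = top_diff b c" and "s = top_diff c d"
  have ne: "q \<noteq> r" "r \<noteq> s" using top_diff_neq abcd by (auto simp: q_def r_def s_def)
  have "top_diff q r \<noteq> top_diff r s" if "q < r \<and> r < s \<or> s < r \<and> r < q"
    using that top_diff_neq[of q r s] top_diff_neq[of s r q] by (auto simp: top_diff_commute)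
  then show ?thesis
    using third_diff_cases[OF abcd q_def[symmetric] r_def[symmetric] s_def[symmetric]] ne
    by (metis less_irrefl linorder_less_linear)
qed

end

section \<open>Homogeneous sequences are short\<close>

text \<open>The largest term, at one end of the run, exceeds the smallest by at least
  \<open>h\<close>.\<close>

lemma monotone_run_bound:
  fixes e :: "nat \<Rightarrow> nat"
  assumes "(\<forall>i<h. e i < e (Suc i)) \<or> (\<forall>i<h. e (Suc i) < e i)"
  shows "\<exists>i\<le>h. h \<le> e i"
  using assms
proof
  assume "\<forall>i<h. e i < e (Suc i)"
  then have "i \<le> h \<Longrightarrow> i \<le> e i" for i
    by (induction i) (auto simp: Suc_le_eq intro: le_less_trans)
  then show ?thesis by blast
next
  assume "\<forall>i<h. e (Suc i) < e i"
  then have step: "e (Suc i) < e i" if "i < h" for i using that by blast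
  have "i \<le> h \<Longrightarrow> e i + i \<le> e 0" for i
  proof (induction i)
    case (Suc i)
    then show ?case using step[of i] by simp
  qed simp
  from this[of h] have "h \<le> e 0" by simp
  then show ?thesis by blast
qed

text \<open>Once \<open>up\<close> fails it fails onwards, so the value at \<open>h\<close> decides
  which half is uniform.\<close>

lemma persistent_dichotomy:
  assumes "\<And>i. i < 2 * h \<Longrightarrow> \<not> up i \<Longrightarrow> \<not> up (Suc i)"
  shows "(\<forall>i\<le>h. up i) \<or> (\<forall>i\<in>{h..2 * h}. \<not> up i)"
proof (rule disjCI)
  assume "\<not> (\<forall>i\<in>{h..2 * h}. \<not> up i)"
  then obtain j where j: "h \<le> j" "j \<le> 2 * h" "up j" by auto
  have "up i" if "i \<le> j" for i
    using that
  proof (induction rule: inc_induct)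
    case (step i)
    then show ?case using assms[of i] j by auto
  qed (use j in auto)
  then show "\<forall>i\<le>h. up i" using j by auto
qed

text \<open>Along a homogeneous sequence the top differing bits between neighbours have no local
  minimum (or no local maximum), so half of them form a monotone run; on a monotone run the same
  argument one level down gives a strictly monotone sequence of numbers below \<open>h\<close>.\<close>

lemma no_homogeneous_sequence:
  fixes h :: nat and t z :: "nat \<Rightarrow> real"
  assumes S: "separated_scales (2 ^ h) w u"
  defines "t \<equiv> level_sum (2 ^ h) w" and "z \<equiv> level_sum (2 ^ h) (\<lambda>l. w l * u l)"
  assumes y: "strict_mono_on {..<2 * h + 3} y" "\<And>i. i < 2 * h + 3 \<Longrightarrow> y i < 2 ^ 2 ^ h"
    and hom: "(\<forall>i<2 * h. 0 < third_diff t z (y i) (y (i + 1)) (y (i + 2)) (y (i + 3))) \<or>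
      (\<forall>i<2 * h. third_diff t z (y i) (y (i + 1)) (y (i + 2)) (y (i + 3)) < 0)"
  shows False
proof -
  \<comment> \<open>Two levels: \<open>f\<close> lists the top bits in which neighbouring strings
    differ, \<open>e\<close> the top bits in which neighbouring values of \<open>f\<close> differ.
    The values of \<open>e\<close> lie below \<open>h\<close>.\<close>
  define f where "f i = top_diff (y i) (y (Suc i))" for i
  define e where "e i = top_diff (f i) (f (Suc i))" for i
  have y_less: "y i < y j" if "i < j" "j < 2 * h + 3" for i j
    using y(1) that by (auto simp: strict_mono_on_def)
  have f_lt: "f i < 2 ^ h" if "i \<le> 2 * h + 1" for i
    unfolding f_def using that by (intro top_diff_less y_less y(2)) auto
  have f_ne: "f i \<noteq> f (Suc i)" if "i \<le> 2 * h" for i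
    unfolding f_def using that by (intro top_diff_neq y_less) auto
  have e_lt: "e i < h" if "i \<le> 2 * h" for i
    unfolding e_def using top_diff_less[of "f i" "f (Suc i)" h] top_diff_less[of "f (Suc i)" "f i" h]
      f_ne[OF that] f_lt[of i] f_lt[of "Suc i"] that
    by (cases "f i < f (Suc i)") (auto simp: top_diff_commute)
  have e_ne: "e i \<noteq> e (Suc i)"
    if "f i < f (Suc i) \<and> f (Suc i) < f (Suc (Suc i)) \<or> f (Suc (Suc i)) < f (Suc i) \<and> f (Suc i) < f i" for i
    using that top_diff_neq[of "f i" "f (Suc i)" "f (Suc (Suc i))"]
      top_diff_neq[of "f (Suc (Suc i))" "f (Suc i)" "f i"]
    unfolding e_def by (simp add: top_diff_commute eq_commute) blast
  define D where "D i = third_diff t z (y i) (y (i + 1)) (y (i + 2)) (y (i + 3))" for i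
  have tri: "(f i < f (Suc i) \<longrightarrow> f (Suc (Suc i)) < f (Suc i) \<longrightarrow> 0 < D i) \<and>
     (f (Suc i) < f i \<longrightarrow> f (Suc i) < f (Suc (Suc i)) \<longrightarrow> D i < 0) \<and>
     (f i < f (Suc i) \<longrightarrow> f (Suc i) < f (Suc (Suc i)) \<longrightarrow>
       (e (Suc i) < e i \<longrightarrow> 0 < D i) \<and> (e i < e (Suc i) \<longrightarrow> D i < 0)) \<and>
     (f (Suc i) < f i \<longrightarrow> f (Suc (Suc i)) < f (Suc i) \<longrightarrow>
       (e i < e (Suc i) \<longrightarrow> 0 < D i) \<and> (e (Suc i) < e i \<longrightarrow> D i < 0))" if "i < 2 * h" for i
  proof -
    have "y i < y (i + 1)" "y (i + 1) < y (i + 2)" "y (i + 2) < y (i + 3)" "y (i + 3) < 2 ^ 2 ^ h"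
      using that by (auto intro!: y_less y(2))
    moreover have "top_diff (y i) (y (i + 1)) = f i" "top_diff (y (i + 1)) (y (i + 2)) = f (Suc i)"
      "top_diff (y (i + 2)) (y (i + 3)) = f (Suc (Suc i))"
      by (simp_all add: f_def numeral_eq_Suc)
    ultimately show ?thesis
      using third_diff_cases[OF S, folded t_def z_def] unfolding D_def e_def by simp
  qed
  have inc: "(0 < D i \<longrightarrow> e (Suc i) < e i) \<and> (D i < 0 \<longrightarrow> e i < e (Suc i))"
    if "i < 2 * h" "f i < f (Suc i)" "f (Suc i) < f (Suc (Suc i))" for i
    using tri[OF that(1)] e_ne[of i] that(2,3) by (cases "e i < e (Suc i)") auto
  have dec: "(0 < D i \<longrightarrow> e i < e (Suc i)) \<and> (D i < 0 \<longrightarrow> e (Suc i) < e i)"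
    if "i < 2 * h" "f (Suc i) < f i" "f (Suc (Suc i)) < f (Suc i)" for i
    using tri[OF that(1)] e_ne[of i] that(2,3) by (cases "e i < e (Suc i)") auto
  have contra: False if "p \<le> h" "(\<forall>i<h. e (p + i) < e (Suc (p + i))) \<or> (\<forall>i<h. e (Suc (p + i)) < e (p + i))" for p
  proof -
    have "\<exists>i\<le>h. h \<le> e (p + i)"
      using monotone_run_bound[of h "\<lambda>i. e (p + i)"] that(2) by simp
    then obtain i where "i \<le> h" "h \<le> e (p + i)" by blast
    then show False using e_lt[of "p + i"] that by auto
  qed
  have rise: "f i < f (Suc i) \<longleftrightarrow> \<not> f (Suc i) < f i" if "i \<le> 2 * h" for i
    using f_ne[OF that] by auto
  show False using hom unfolding D_def[symmetric]
  proof
    assume pos: "\<forall>i<2 * h. 0 < D i"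
    \<comment> \<open>Positive signs rule out local minima of \<open>f\<close>, so a descent is
      never followed by an ascent.\<close>
    have "(\<forall>i\<le>h. f i < f (Suc i)) \<or> (\<forall>i\<in>{h..2 * h}. \<not> f i < f (Suc i))"
    proof (rule persistent_dichotomy)
      fix i assume i: "i < 2 * h" "\<not> f i < f (Suc i)"
      show "\<not> f (Suc i) < f (Suc (Suc i))"
        using tri[OF i(1)] pos[rule_format, OF i(1)] i rise[of i] by auto
    qed
    then show False
    proof
      assume up: "\<forall>i\<le>h. f i < f (Suc i)"
      have "e (Suc (0 + i)) < e (0 + i)" if "i < h" for i
        using inc[of i] pos up that by simp
      then show False using contra[of 0] by blast
    next
      assume down: "\<forall>i\<in>{h..2 * h}. \<not> f i < f (Suc i)"
      have "e (h + i) < e (Suc (h + i))" if "i < h" for i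
        using dec[of "h + i"] pos down rise[of "h + i"] rise[of "Suc (h + i)"] that by simp
      then show False using contra[of h] by blast
    qed
  next
    assume neg: "\<forall>i<2 * h. D i < 0"
    \<comment> \<open>Negative signs rule out local maxima, and ascents and descents exchange
      roles.\<close>
    have "(\<forall>i\<le>h. f (Suc i) < f i) \<or> (\<forall>i\<in>{h..2 * h}. \<not> f (Suc i) < f i)"
    proof (rule persistent_dichotomy)
      fix i assume i: "i < 2 * h" "\<not> f (Suc i) < f i"
      show "\<not> f (Suc (Suc i)) < f (Suc i)"
        using tri[OF i(1)] neg[rule_format, OF i(1)] i rise[of i] by auto
    qed
    then show False
    proof
      assume down: "\<forall>i\<le>h. f (Suc i) < f i"
      have "e (Suc (0 + i)) < e (0 + i)" if "i < h" for i
        using dec[of i] neg down that by simp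
      then show False using contra[of 0] by blast
    next
      assume up: "\<forall>i\<in>{h..2 * h}. \<not> f (Suc i) < f i"
      have "e (h + i) < e (Suc (h + i))" if "i < h" for i
        using inc[of "h + i"] neg up rise[of "h + i"] rise[of "Suc (h + i)"] that by simp
      then show False using contra[of h] by blast
    qed
  qed
qed

section \<open>Bounds for AB\<close>

text \<open>By \<open>orient3_exchange\<close>, each further quadruple is a combination of
  \<open>abcd\<close> and \<open>bcde\<close> with positive weights, so their common sign passes
  on.\<close>

lemma above_transitive:
  fixes a b c d e :: "real^3"
  assumes pos: "s * orient2 (proj a) (proj b) (proj c) > 0"
    "s * orient2 (proj a) (proj b) (proj d) > 0"
    "s * orient2 (proj a) (proj b) (proj e) > 0"
    "s * orient2 (proj a) (proj c) (proj d) > 0"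
    "s * orient2 (proj a) (proj c) (proj e) > 0"
    "s * orient2 (proj a) (proj d) (proj e) > 0"
    "s * orient2 (proj b) (proj c) (proj d) > 0"
    "s * orient2 (proj b) (proj c) (proj e) > 0"
    "s * orient2 (proj b) (proj d) (proj e) > 0"
    "s * orient2 (proj c) (proj d) (proj e) > 0"
  shows "above a c b d \<Longrightarrow> above b d c e \<Longrightarrow> above a c b e \<and> above a d b e \<and> above a d c e"
    and "\<not> above a c b d \<Longrightarrow> \<not> above b d c e \<Longrightarrow> \<not> above a c b e \<and> \<not> above a d b e \<and> \<not> above a d c e"
proof -
  define o2 where "o2 p q r = orient2 (proj p) (proj q) (proj r)" for p q r :: "real^3"
  note iff = above_iff_orient3[OF pos(1,2,4,7)] above_iff_orient3[OF pos(7-10)]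
    above_iff_orient3[OF pos(1,3,5,8)] above_iff_orient3[OF pos(2,3,6,9)] above_iff_orient3[OF pos(4,5,6,10)]
  note pos = pos[folded o2_def]
  \<comment> \<open>Multiplying by \<open>s\<close> twice keeps each relation valid while making all
    planar factors positive.\<close>
  have scale: "(s * X) * (s * o2 b c d) = (s * Y) * (s * p) + (s * Z) * (s * q)"
    if "X * o2 b c d = Y * p + Z * q" for X Y Z p q
    using that by algebra
  note eqs = orient3_exchange[where a=a and b=b and c=c and d=d and e=e, folded o2_def, THEN scale]
  have pos_comb: "X > 0" if "X * B = U * p + V * q" "B > 0" "p > 0" "q > 0" "U > 0" "V > 0"
    for X B U V p q :: real
  proof -
    have "X * B > 0" unfolding that(1) using that by (simp add: add_pos_pos)
    then show ?thesis using that(2) by (rule zero_less_mult_pos2)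
  qed
  have nonpos_comb: "\<not> X > 0" if "X * B = U * p + V * q" "B > 0" "p > 0" "q > 0" "\<not> U > 0" "\<not> V > 0"
    for X B U V p q :: real
  proof
    assume "X > 0"
    then have "U * p + V * q > 0" using that(2) by (simp flip: that(1))
    moreover have "U * p \<le> 0" "V * q \<le> 0" using that by (auto intro: mult_nonpos_nonneg)
    ultimately show False by linarith
  qed
  show "above a c b e \<and> above a d b e \<and> above a d c e" if "above a c b d" "above b d c e"
    using that pos_comb[OF eqs(1)] pos_comb[OF eqs(2)] pos_comb[OF eqs(3)] pos unfolding iff by blast
  show "\<not> above a c b e \<and> \<not> above a d b e \<and> \<not> above a d c e" if "\<not> above a c b d" "\<not> above b d c e"
    using that nonpos_comb[OF eqs(1)] nonpos_comb[OF eqs(2)] nonpos_comb[OF eqs(3)] pos unfolding iff by blast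
qed

text \<open>A monochromatic path with \<open>k - 3\<close> quadruples has \<open>k\<close> vertices,
  and transitivity makes its vertex set homogeneous.\<close>

lemma has_AB_subsequence_of_large:
  assumes k: "k \<ge> 4" and N: "2 ^ (4 ^ (k - 3)) < N" and x: "admissible N x"
  shows "has_AB_subsequence k N x"
proof -
  define R where "R a b c d = above (x a) (x c) (x b) (x d)" for a b c d
  define n where "n = k - 3"
  have n: "0 < n" "n + 3 = k" using k by (auto simp: n_def)
  obtain s :: real where s: "\<And>i j l. 1 \<le> i \<Longrightarrow> i < j \<Longrightarrow> j < l \<Longrightarrow> l \<le> N \<Longrightarrow>
      s * orient2 (proj (x i)) (proj (x j)) (proj (x l)) > 0"
    using x convex_polygon_orientation unfolding admissible_def by metis
  have trans: "(R a b c d \<longrightarrow> R b c d e \<longrightarrow> R a b c e \<and> R a b d e \<and> R a c d e) \<and>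
      (\<not> R a b c d \<longrightarrow> \<not> R b c d e \<longrightarrow> \<not> R a b c e \<and> \<not> R a b d e \<and> \<not> R a c d e)"
    if "1 \<le> a" "a < b" "b < c" "c < d" "d < e" "e \<le> N" for a b c d e
  proof -
    have "s * orient2 (proj (x i)) (proj (x j)) (proj (x l)) > 0"
      if "(i, j, l) \<in> {(a,b,c), (a,b,d), (a,b,e), (a,c,d), (a,c,e), (a,d,e), (b,c,d), (b,c,e), (b,d,e), (c,d,e)}" for i j l
      using that \<open>1 \<le> a\<close> \<open>a < b\<close> \<open>b < c\<close> \<open>c < d\<close> \<open>d < e\<close> \<open>e \<le> N\<close> by (intro s) auto
    note pos = this[of a b c] this[of a b d] this[of a b e] this[of a c d] this[of a c e] this[of a d e]
      this[of b c d] this[of b c e] this[of b d e] this[of c d e]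
    show ?thesis
      unfolding R_def using above_transitive[OF pos] by (intro conjI impI) blast+
  qed
  \<comment> \<open>Stated for any transitive \<open>Q\<close>, to serve both \<open>R\<close> and
    its negation.\<close>
  have subseq: "\<exists>i. strict_mono_on {1..k} i \<and> i ` {1..k} \<subseteq> {1..N} \<and>
      (\<forall>r s t u. 1 \<le> r \<and> r < s \<and> s < t \<and> t < u \<and> u \<le> k \<longrightarrow> Q (i r) (i s) (i t) (i u))"
    if path: "path_end Q n a b c" "c \<le> N"
      and tr: "\<And>a b c d e. 1 \<le> a \<Longrightarrow> a < b \<Longrightarrow> b < c \<Longrightarrow> c < d \<Longrightarrow> d < e \<Longrightarrow> e \<le> N \<Longrightarrow>
        Q a b c d \<Longrightarrow> Q b c d e \<Longrightarrow> Q a b c e \<and> Q a b d e \<and> Q a c d e" for Q a b c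
  proof -
    obtain y where y: "strict_mono_on {..<k} y" "1 \<le> y 0" "y (n + 2) = c"
      and Qy: "\<And>i. i < n \<Longrightarrow> Q (y i) (y (i + 1)) (y (i + 2)) (y (i + 3))"
      using path_end_sequence[OF path(1)] n(2) by auto
    have less: "y i < y j" if "i < j" "j < k" for i j using y(1) that by (auto simp: strict_mono_on_def)
    have range: "1 \<le> y i" "y i \<le> N" if "i < k" for i
      using strict_mono_on_leD[OF y(1), of 0 i] strict_mono_on_leD[OF y(1), of i "n + 2"] that n y path(2)
      by auto
    have clique: "Q (y a) (y b) (y c) (y d)" if "a < b" "b < c" "c < d" "d < k" for a b c d
    proof (rule transitive_path_imp_clique[where Q = "\<lambda>a b c d. Q (y a) (y b) (y c) (y d)" and m = k])
      fix a b c d e assume "a < b" "b < c" "c < d" "d < e" "e < k"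
        "Q (y a) (y b) (y c) (y d)" "Q (y b) (y c) (y d) (y e)"
      then show "Q (y a) (y b) (y c) (y e) \<and> Q (y a) (y b) (y d) (y e) \<and> Q (y a) (y c) (y d) (y e)"
        by (intro tr less range) auto
    next
      fix i assume "i + 3 < k"
      then show "Q (y i) (y (i + 1)) (y (i + 2)) (y (i + 3))" using n by (intro Qy) auto
    qed (use that in auto)
    define i where "i r = y (r - 1)" for r
    have "strict_mono_on {1..k} i" by (rule strict_mono_onI) (auto simp: i_def intro: less)
    moreover have "i ` {1..k} \<subseteq> {1..N}" using range by (auto simp: i_def)
    moreover have "Q (i r) (i s) (i t) (i u)" if "1 \<le> r \<and> r < s \<and> s < t \<and> t < u \<and> u \<le> k" for r s t u
      unfolding i_def using that by (intro clique) auto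
    ultimately show ?thesis by blast
  qed
  obtain a b c where c: "c \<le> N" "path_end R n a b c \<or> path_end (\<lambda>a b c d. \<not> R a b c d) n a b c"
    using long_path_end_exists[OF n(1), of N R] N by (auto simp: n_def)
  from c(2) show ?thesis
  proof
    assume "path_end R n a b c"
    from subseq[OF this c(1)] trans show ?thesis
      unfolding has_AB_subsequence_def R_def by blast
  next
    assume "path_end (\<lambda>a b c d. \<not> R a b c d) n a b c"
    from subseq[OF this c(1)] trans show ?thesis
      unfolding has_AB_subsequence_def R_def below_def by blast
  qed
qed

section \<open>Lower bound and conclusion\<close>

text \<open>Indices up to \<open>N\<close> are read as binary strings of length
  \<open>2 ^ h\<close>; among them \<open>no_homogeneous_sequence\<close> excludes homogeneous
  sequences of \<open>2 * h + 3\<close> points.\<close>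

lemma not_AB_good:
  assumes k: "2 * h + 3 \<le> k" and N: "N < 2 ^ 2 ^ h"
  shows "\<not> AB_good k N"
proof (cases "N \<ge> 3")
  case True
  obtain w u where S: "separated_scales (2 ^ h) w u" using separated_scales_exist by blast
  define t z where "t = level_sum (2 ^ h) w" and "z = level_sum (2 ^ h) (\<lambda>l. w l * u l)"
  have t_less: "t a < t b" if "a < b" "b \<le> N" for a b
    using level_distance_bounds(3)[OF S that(1) _ refl] that N by (simp add: t_def)
  have nz: "third_diff t z a b c d \<noteq> 0" if "a < b" "b < c" "c < d" "d \<le> N" for a b c d
    using third_diff_nonzero[OF S that(1-3)] that N by (simp add: t_def z_def)
  have "admissible N (parabola_lift t z)"
    using True t_less nz by (intro admissible_lift) (auto intro: strict_mono_onI)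
  moreover have "\<not> has_AB_subsequence k N (parabola_lift t z)"
  proof
    assume "has_AB_subsequence k N (parabola_lift t z)"
    then obtain i where i: "strict_mono_on {1..k} i" "i ` {1..k} \<subseteq> {1..N}"
      and hom: "(\<forall>r s' t' u. 1 \<le> r \<and> r < s' \<and> s' < t' \<and> t' < u \<and> u \<le> k \<longrightarrow>
            above (parabola_lift t z (i r)) (parabola_lift t z (i t')) (parabola_lift t z (i s')) (parabola_lift t z (i u))) \<or>
         (\<forall>r s' t' u. 1 \<le> r \<and> r < s' \<and> s' < t' \<and> t' < u \<and> u \<le> k \<longrightarrow>
            below (parabola_lift t z (i r)) (parabola_lift t z (i t')) (parabola_lift t z (i s')) (parabola_lift t z (i u)))"
      unfolding has_AB_subsequence_def by blast
    define y where "y j = i (Suc j)" for j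
    have y_less: "y p < y q" if "p < q" "q < 2 * h + 3" for p q
      using i(1) that k by (auto simp: strict_mono_on_def y_def)
    have y_le: "y p \<le> N" if "p < 2 * h + 3" for p
      using i(2) that k by (auto simp: y_def image_subset_iff)
    have iff: "above (parabola_lift t z (y j)) (parabola_lift t z (y (j + 2))) (parabola_lift t z (y (j + 1))) (parabola_lift t z (y (j + 3))) \<longleftrightarrow>
        third_diff t z (y j) (y (j + 1)) (y (j + 2)) (y (j + 3)) < 0" if "j < 2 * h" for j
      using that by (intro above_lift_iff t_less y_less y_le) auto
    have nzy: "third_diff t z (y j) (y (j + 1)) (y (j + 2)) (y (j + 3)) \<noteq> 0" if "j < 2 * h" for j
      using that by (intro nz y_less y_le) auto
    have idx: "1 \<le> Suc j \<and> Suc j < Suc (j + 1) \<and> Suc (j + 1) < Suc (j + 2) \<and> Suc (j + 2) < Suc (j + 3) \<and> Suc (j + 3) \<le> k"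
      if "j < 2 * h" for j using that k by auto
    have "(\<forall>j<2 * h. 0 < third_diff t z (y j) (y (j + 1)) (y (j + 2)) (y (j + 3))) \<or>
      (\<forall>j<2 * h. third_diff t z (y j) (y (j + 1)) (y (j + 2)) (y (j + 3)) < 0)"
      using hom
    proof
      assume h: "\<forall>r s' t' u. 1 \<le> r \<and> r < s' \<and> s' < t' \<and> t' < u \<and> u \<le> k \<longrightarrow>
            above (parabola_lift t z (i r)) (parabola_lift t z (i t')) (parabola_lift t z (i s')) (parabola_lift t z (i u))"
      have "third_diff t z (y j) (y (j + 1)) (y (j + 2)) (y (j + 3)) < 0" if "j < 2 * h" for j
        using h[rule_format, OF idx[OF that]] iff[OF that] unfolding y_def by blast
      then show ?thesis by blast
    next
      assume h: "\<forall>r s' t' u. 1 \<le> r \<and> r < s' \<and> s' < t' \<and> t' < u \<and> u \<le> k \<longrightarrow>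
            below (parabola_lift t z (i r)) (parabola_lift t z (i t')) (parabola_lift t z (i s')) (parabola_lift t z (i u))"
      have "\<not> third_diff t z (y j) (y (j + 1)) (y (j + 2)) (y (j + 3)) < 0" if "j < 2 * h" for j
        using h[rule_format, OF idx[OF that]] iff[OF that] unfolding y_def below_def by blast
      \<comment> \<open>\<open>below\<close> gives only nonnegativity; nonvanishing makes it
        strict.\<close>
      then show ?thesis using nzy by (metis linorder_neqE_linordered_idom)
    qed
    then show False
      using no_homogeneous_sequence[OF S, of y, folded t_def z_def] y_less y_le N
      by (force intro: strict_mono_onI le_less_trans)
  qed
  ultimately show ?thesis unfolding AB_good_def by blast
qed (simp add: AB_good_def)

theorem theorem1p1:
  shows "\<exists>c C :: real. c > 0 \<and> C > 0 \<and>
    (\<forall>k::nat. k \<ge> 4 \<longrightarrow>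
       (\<exists>N. AB_good k N) \<and>
       2 powr (2 powr (c * real k)) \<le> real (AB k) \<and>
       real (AB k) \<le> 2 powr (2 powr (C * real k)))"
\<comment> \<open>\<open>4 ^ k = 2 ^ (2 * k)\<close> gives \<open>C = 2\<close>;
  \<open>c = 1/8\<close> works since \<open>k \<le> 8 * ((k - 3) div 2)\<close> for
  \<open>k \<ge> 5\<close>.\<close>
proof (rule exI[of _ "1/8"], rule exI[of _ "2"], intro conjI allI impI)
  fix k :: nat assume k: "k \<ge> 4"
  define M :: nat where "M = 2 ^ (4 ^ (k - 3)) + 1"
  \<comment> \<open>Secures \<open>M \<ge> 3\<close>, as \<open>AB_good\<close> demands.\<close>
  have "(2::nat) ^ 1 \<le> 2 ^ (4 ^ (k - 3))" by (intro power_increasing) auto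
  then have "AB_good k M"
    unfolding AB_good_def using has_AB_subsequence_of_large[OF k] by (auto simp: M_def)
  then show "\<exists>N. AB_good k N" by blast
  have good: "AB_good k (AB k)" unfolding AB_def using \<open>AB_good k M\<close> by (rule LeastI)
  have "AB k \<le> M" unfolding AB_def using \<open>AB_good k M\<close> by (rule Least_le)
  also have "M \<le> 2 ^ (4 ^ k)"
  proof -
    have "4 ^ (k - 3) < (4::nat) ^ k" using k by (intro power_strict_increasing) auto
    then have "(2::nat) ^ (4 ^ (k - 3)) < 2 ^ (4 ^ k)" by (intro power_strict_increasing) auto
    then show ?thesis by (simp only: M_def Suc_eq_plus1[symmetric] Suc_le_eq)
  qed
  finally have "real (AB k) \<le> real (2 ^ (4 ^ k))" by (simp only: of_nat_le_iff)
  also have "\<dots> = 2 powr (2 powr (2 * real k))"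
  proof -
    have "2 powr (2 * real k) = (2 powr 2) powr real k" by (simp only: powr_powr)
    also have "\<dots> = real (4 ^ k)" by (simp add: powr_realpow)
    finally have e: "2 powr (2 * real k) = real (4 ^ k)" .
    show ?thesis unfolding e by (subst powr_realpow) simp_all
  qed
  finally show "real (AB k) \<le> 2 powr (2 powr (2 * real k))" .
  define h where "h = (k - 3) div 2"
  have h: "2 * h + 3 \<le> k" using k by (auto simp: h_def)
  show "2 powr (2 powr (1 / 8 * real k)) \<le> real (AB k)"
  proof (cases "k = 4")
    \<comment> \<open>Here \<open>h = 0\<close> and the construction gives too little; the bound
      \<open>3\<close> built into \<open>AB_good\<close> exceeds
      \<open>2 powr sqrt 2\<close>.\<close>
    case True
    have sqrt2: "sqrt 2 \<le> 3/2" by (rule real_le_lsqrt) (simp_all add: power2_eq_square)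
    then have "2 powr (2 powr (1/2)) \<le> (2::real) powr (3/2)"
      by (intro powr_mono) (auto simp: powr_half_sqrt)
    also have "\<dots> = sqrt (2 powr 3)" by (subst powr_half_sqrt[symmetric], simp, subst powr_powr, simp)
    also have "\<dots> \<le> 3" by (rule real_le_lsqrt) simp_all
    also have "\<dots> \<le> real (AB k)" using good by (simp add: AB_good_def)
    finally show ?thesis using True by simp
  next
    case False
    then have "k \<le> 8 * h" using k unfolding h_def by presburger
    then have "1 / 8 * real k \<le> real h" by simp
    then have "2 powr (1 / 8 * real k) \<le> 2 powr (real h)" by (intro powr_mono) auto
    also have "\<dots> = real (2 ^ h)" by (simp add: powr_realpow)
    finally have "2 powr (2 powr (1 / 8 * real k)) \<le> 2 powr (real (2 ^ h))" by (intro powr_mono) auto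
    also have "\<dots> = real (2 ^ 2 ^ h)" by (subst powr_realpow) simp_all
    also have "\<dots> \<le> real (AB k)" using not_AB_good[OF h] good by (metis not_le_imp_less of_nat_le_iff)
    finally show ?thesis .
  qed
qed simp_all

end
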